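(* Let $X_0$ be a compact metrizable space, $\mathfrak A=C(X_0)$, and let $G$ be a unimodular, amenable, second-countable locally compact group acting on $\mathfrak A$ by $\theta:G\to\mathrm{Aut}(\mathfrak A)$ so that $(\mathfrak A,G,\theta)$ is a uniquely ergodic $C^*$-dynamical system. Let $\alpha\in\mathrm{Aut}(\mathfrak A)$ commute with every $\theta_g$, let $u=(u_g)_{g\in G}$ be a continuous $1$-cocycle, and let $(\mathfrak A\rtimes_\alpha\mathbb Z,G,\Phi^u)$ be the associated skew product. If $(\mathfrak A\rtimes_\alpha\mathbb Z,G,\Phi^u)$ is not weakly ergodic, then the fixed-point subalgebra $(\mathfrak A\rtimes_\alpha\mathbb Z)^G$ is isomorphic (as a $C^*$-algebra) with $C(\mathbb T)$.
   Context: A $C^*$-dynamical system $(\mathfrak B,G,\beta)$ is a unital $C^*$-algebra $\mathfrak B$ with a group homomorphism $\beta:G\to\mathrm{Aut}(\mathfrak B)$ such that $g\mapsto\beta_g(b)$ is norm continuous for every $b\in\mathfrak B$. It is uniquely ergodic if there is exactly one $G$-invariant state (state $\varphi$ with $\varphi\circ\beta_g=\varphi$ for all $g$). Its fixed-point subalgebra is $\mathfrak B^G=\{b:\beta_g(b)=b\ \forall g\in G\}$; the system is weakly ergodic if $\mathfrak B^G=\mathbb C1$. A continuous $1$-cocycle is a continuous function $u:G\times X_0\to\mathbb T$ which, writing $u_g:=u(g,\cdot)\in C(X_0)$, satisfies $u_{gh}=\theta_g(u_h)u_g$ for all $g,h\in G$. $\mathfrak A\rtimes_\alpha\mathbb Z$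 is the universal crossed product, generated by $\mathfrak A$ and a unitary $V$ with $VaV^*=\alpha(a)$ for $a\in\mathfrak A$. For $g\in G$, $\Phi^u_g$ is the automorphism of $\mathfrak A\rtimes_\alpha\mathbb Z$ with $\Phi^u_g(a)=\theta_g(a)$ for $a\in\mathfrak A$ and $\Phi^u_g(V)=u_gV$. *)

theory Defs
  imports "HOL-Analysis.Analysis"
begin

section \<open>Unital $C^*$-algebras\<close>

text \<open>
  The class is built on the complex Banach algebra axioms; the underlying real structure is the
  one of the library. Since \<^class>\<open>real_normed_algebra_1\<close> requires \<open>norm 1 = 1\<close>, only the zero
  algebra (which has no states) is excluded.
\<close>

class unital_cstar_algebra = real_normed_algebra_1 + banach +
  fixes scaleC :: "complex \<Rightarrow> 'a \<Rightarrow> 'a" (infixr \<open>*\<^sub>C\<close> 75)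
    and star :: "'a \<Rightarrow> 'a"
  assumes scaleC_add_right: "c *\<^sub>C (x + y) = c *\<^sub>C x + c *\<^sub>C y"
    and scaleC_add_left: "(c + d) *\<^sub>C x = c *\<^sub>C x + d *\<^sub>C x"
    and scaleC_scaleC: "c *\<^sub>C (d *\<^sub>C x) = (c * d) *\<^sub>C x"
    and scaleC_of_real: "complex_of_real r *\<^sub>C x = r *\<^sub>R x"
    and mult_scaleC_left: "(c *\<^sub>C x) * y = c *\<^sub>C (x * y)"
    and mult_scaleC_right: "x * (c *\<^sub>C y) = c *\<^sub>C (x * y)"
    and norm_scaleC: "norm (c *\<^sub>C x) = cmod c * norm x"
    and star_star: "star (star x) = x"
    and star_add: "star (x + y) = star x + star y"
    and star_scaleC: "star (c *\<^sub>C x) = cnj c *\<^sub>C star x"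
    and star_mult: "star (x * y) = star y * star x"
    and norm_star_mult_self: "norm (star x * x) = (norm x)\<^sup>2"

instantiation complex :: unital_cstar_algebra
begin

definition scaleC_complex :: "complex \<Rightarrow> complex \<Rightarrow> complex"
  where "scaleC_complex c x = c * x"

definition star_complex :: "complex \<Rightarrow> complex"
  where "star_complex = cnj"

instance
  by standard
    (auto simp: scaleC_complex_def star_complex_def algebra_simps norm_mult scaleR_conv_of_real
      power2_eq_square)

end

lemma star_zero [simp]: "star (0 :: 'a::unital_cstar_algebra) = 0"
  using star_add[of "0::'a" 0] by simp

lemma star_one [simp]: "star (1 :: 'a::unital_cstar_algebra) = 1"
  by (metis mult.right_neutral mult_1 star_mult star_star)

lemma norm_star [simp]: "norm (star x) = norm (x :: 'a::unital_cstar_algebra)"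
proof -
  have le: "norm x \<le> norm (star x)" for x :: 'a
  proof (cases "x = 0")
    case False
    have "norm x * norm x \<le> norm (star x) * norm x"
      using norm_mult_ineq[of "star x" x] norm_star_mult_self[of x] by (simp add: power2_eq_square)
    with False show ?thesis by simp
  qed simp
  show ?thesis
    using le[of x] le[of "star x"] by (simp add: star_star)
qed

lemma star_minus: "star (- x) = - star (x :: 'a::unital_cstar_algebra)"
  using star_add[of "- x" x] by (simp add: eq_neg_iff_add_eq_0)

lemma star_diff: "star (x - y) = star x - star (y :: 'a::unital_cstar_algebra)"
  using star_add[of x "- y"] by (simp add: star_minus)

lemma star_sum: "star (sum f A) = (\<Sum>i\<in>A. star (f i :: 'a::unital_cstar_algebra))"
  by (induction A rule: infinite_finite_induct) (simp_all add: star_add)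

lemma scaleC_zero_right [simp]: "c *\<^sub>C (0 :: 'a::unital_cstar_algebra) = 0"
  using scaleC_add_right[of c "0::'a" 0] by simp

lemma scaleC_sum: "c *\<^sub>C sum f A = (\<Sum>i\<in>A. c *\<^sub>C (f i :: 'a::unital_cstar_algebra))"
  by (induction A rule: infinite_finite_induct) (simp_all add: scaleC_add_right)

lemma scaleC_minus_one: "(-1) *\<^sub>C x = - (x :: 'a::unital_cstar_algebra)"
  using scaleC_of_real[of "-1" x] by simp

lemma continuous_on_star [continuous_intros]:
  assumes "continuous_on S f"
  shows "continuous_on S (\<lambda>x. star (f x :: 'a::unital_cstar_algebra))"
proof -
  have "bounded_linear (star :: 'a \<Rightarrow> 'a)"
    by (rule bounded_linear_intro[where K = 1])
      (simp_all add: star_add scaleC_of_real[symmetric] star_scaleC)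
  then show ?thesis
    using assms by (rule bounded_linear.continuous_on)
qed

lemma continuous_on_scaleC [continuous_intros]:
  assumes "continuous_on S f"
  shows "continuous_on S (\<lambda>x. c *\<^sub>C (f x :: 'a::unital_cstar_algebra))"
proof -
  have "bounded_linear ((*\<^sub>C) c :: 'a \<Rightarrow> 'a)"
    by (rule bounded_linear_intro[where K = "cmod c"])
      (simp_all add: scaleC_add_right scaleC_of_real[symmetric] scaleC_scaleC norm_scaleC
        mult.commute)
  then show ?thesis
    using assms by (rule bounded_linear.continuous_on)
qed

text \<open>
  Continuous functions with the supremum norm and pointwise operations. On a compact space every
  continuous function is bounded, so for compact \<open>X\<close> the type \<open>X \<Rightarrow>\<^sub>C complex\<close> is $C(X)$.
\<close>

lemma bcontfun_mult:
  fixes f g :: "'a::topological_space \<Rightarrow> 'b::real_normed_algebra"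
  assumes "f \<in> bcontfun" "g \<in> bcontfun"
  shows "(\<lambda>x. f x * g x) \<in> bcontfun"
proof -
  obtain B where B: "\<And>x. norm (f x) \<le> B"
    using assms(1) by (auto simp: bcontfun_def bounded_iff)
  obtain C where C: "\<And>x. norm (g x) \<le> C"
    using assms(2) by (auto simp: bcontfun_def bounded_iff)
  have "norm (f x * g x) \<le> B * C" for x
    by (rule order_trans[OF norm_mult_ineq])
      (use B C in \<open>auto intro!: mult_mono intro: order_trans[OF norm_ge_zero]\<close>)
  then show ?thesis
    using assms by (intro bcontfun_normI[where b = "B * C"]) (auto simp: bcontfun_def intro!: continuous_intros)
qed

instantiation bcontfun :: (metric_space, unital_cstar_algebra) unital_cstar_algebra
begin

definition one_bcontfun :: "'a \<Rightarrow>\<^sub>C 'b"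
  where "one_bcontfun = Bcontfun (\<lambda>_. 1)"

definition times_bcontfun :: "('a \<Rightarrow>\<^sub>C 'b) \<Rightarrow> ('a \<Rightarrow>\<^sub>C 'b) \<Rightarrow> ('a \<Rightarrow>\<^sub>C 'b)"
  where "times_bcontfun f g = Bcontfun (\<lambda>x. f x * g x)"

definition scaleC_bcontfun :: "complex \<Rightarrow> ('a \<Rightarrow>\<^sub>C 'b) \<Rightarrow> ('a \<Rightarrow>\<^sub>C 'b)"
  where "scaleC_bcontfun c f = Bcontfun (\<lambda>x. c *\<^sub>C f x)"

definition star_bcontfun :: "('a \<Rightarrow>\<^sub>C 'b) \<Rightarrow> ('a \<Rightarrow>\<^sub>C 'b)"
  where "star_bcontfun f = Bcontfun (\<lambda>x. star (f x))"

lemma apply_bcontfun_one [simp]: "apply_bcontfun (1 :: 'a \<Rightarrow>\<^sub>C 'b) x = 1"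
  by (simp add: one_bcontfun_def Bcontfun_inverse const_bcontfun)

lemma apply_bcontfun_times [simp]:
  "apply_bcontfun (f * g :: 'a \<Rightarrow>\<^sub>C 'b) x = apply_bcontfun f x * apply_bcontfun g x"
  by (simp add: times_bcontfun_def Bcontfun_inverse bcontfun_mult apply_bcontfun)

lemma apply_bcontfun_scaleC [simp]:
  "apply_bcontfun (c *\<^sub>C f :: 'a \<Rightarrow>\<^sub>C 'b) x = c *\<^sub>C apply_bcontfun f x"
proof -
  have "(\<lambda>x. c *\<^sub>C apply_bcontfun f x) \<in> bcontfun"
    by (intro bcontfun_normI[where b = "cmod c * norm f"])
      (auto intro!: continuous_intros mult_left_mono norm_bounded simp: norm_scaleC)
  then show ?thesis by (simp add: scaleC_bcontfun_def Bcontfun_inverse)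
qed

lemma apply_bcontfun_star [simp]:
  "apply_bcontfun (star f :: 'a \<Rightarrow>\<^sub>C 'b) x = star (apply_bcontfun f x)"
proof -
  have "(\<lambda>x. star (apply_bcontfun f x)) \<in> bcontfun"
    by (intro bcontfun_normI[where b = "norm f"]) (auto intro!: continuous_intros norm_bounded)
  then show ?thesis by (simp add: star_bcontfun_def Bcontfun_inverse)
qed

instance
proof
  fix f g h :: "'a \<Rightarrow>\<^sub>C 'b" and c d :: complex and r :: real
  show "f * g * h = f * (g * h)" "(f + g) * h = f * h + g * h" "f * (g + h) = f * g + f * h"
    "r *\<^sub>R f * g = r *\<^sub>R (f * g)" "f * r *\<^sub>R g = r *\<^sub>R (f * g)" "1 * f = f" "f * 1 = f"
    by (auto intro!: bcontfun_eqI simp: algebra_simps)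
  show "(0 :: 'a \<Rightarrow>\<^sub>C 'b) \<noteq> 1"
    by (metis apply_bcontfun_one zero_bcontfun.rep_eq zero_neq_one)
  show mult: "norm (f * g) \<le> norm f * norm g" for f g :: "'a \<Rightarrow>\<^sub>C 'b"
    by (rule norm_bound)
      (auto intro!: order_trans[OF norm_mult_ineq] mult_mono norm_bounded)
  show "norm (1 :: 'a \<Rightarrow>\<^sub>C 'b) = 1"
    using norm_bounded[of "1 :: 'a \<Rightarrow>\<^sub>C 'b" undefined]
    by (intro antisym norm_bound) auto
  show "c *\<^sub>C (f + g) = c *\<^sub>C f + c *\<^sub>C g" "(c + d) *\<^sub>C f = c *\<^sub>C f + d *\<^sub>C f"
    "c *\<^sub>C d *\<^sub>C f = (c * d) *\<^sub>C f" "complex_of_real r *\<^sub>C f = r *\<^sub>R f"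
    "c *\<^sub>C f * g = c *\<^sub>C (f * g)" "f * c *\<^sub>C g = c *\<^sub>C (f * g)"
    "star (star f) = f" "star (f + g) = star f + star g" "star (c *\<^sub>C f) = cnj c *\<^sub>C star f"
    "star (f * g) = star g * star f"
    by (auto intro!: bcontfun_eqI simp: scaleC_add_right scaleC_add_left scaleC_scaleC
        scaleC_of_real mult_scaleC_left mult_scaleC_right star_star star_add star_scaleC star_mult)
  have le: "norm (c *\<^sub>C f) \<le> cmod c * norm f" for c and f :: "'a \<Rightarrow>\<^sub>C 'b"
    by (rule norm_bound) (auto intro!: mult_left_mono norm_bounded simp: norm_scaleC)
  show "norm (c *\<^sub>C f) = cmod c * norm f"
  proof (cases "c = 0")
    case True
    then show ?thesis using le[of 0 f] by simp
  next
    case False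
    have "inverse c *\<^sub>C c *\<^sub>C f = f"
      using False by (auto intro!: bcontfun_eqI simp: scaleC_scaleC)
        (metis of_real_1 scaleC_of_real scaleR_one)
    then have "norm f \<le> cmod (inverse c) * norm (c *\<^sub>C f)"
      using le[of "inverse c" "c *\<^sub>C f"] by simp
    then have "cmod c * norm f \<le> norm (c *\<^sub>C f)"
      using False by (simp add: norm_inverse norm_divide field_simps)
    with le[of c f] show ?thesis by simp
  qed
  have star_le: "norm (star f) \<le> norm f" for f :: "'a \<Rightarrow>\<^sub>C 'b"
    by (rule norm_bound) (auto intro!: norm_bounded)
  show "norm (star f * f) = (norm f)\<^sup>2"
  proof (rule antisym)
    have "norm (star f * f) \<le> norm (star f) * norm f" by (rule mult)
    also have "\<dots> \<le> norm f * norm f" by (intro mult_right_mono star_le) auto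
    finally show "norm (star f * f) \<le> (norm f)\<^sup>2" by (simp add: power2_eq_square)
    have "norm f \<le> sqrt (norm (star f * f))"
    proof (rule norm_bound)
      fix x
      have "(norm (apply_bcontfun f x))\<^sup>2 \<le> norm (star f * f)"
        using norm_bounded[of "star f * f" x] by (simp add: norm_star_mult_self)
      then show "norm (apply_bcontfun f x) \<le> sqrt (norm (star f * f))"
        by (rule real_le_rsqrt)
    qed
    then have "(norm f)\<^sup>2 \<le> (sqrt (norm (star f * f)))\<^sup>2" by (intro power_mono) auto
    then show "(norm f)\<^sup>2 \<le> norm (star f * f)" by simp
  qed
qed

end

definition unital_star_hom :: "('a::unital_cstar_algebra \<Rightarrow> 'b::unital_cstar_algebra) \<Rightarrow> bool"
  where "unital_star_hom \<pi> \<longleftrightarrow>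
    (\<forall>x y. \<pi> (x + y) = \<pi> x + \<pi> y) \<and> (\<forall>c x. \<pi> (c *\<^sub>C x) = c *\<^sub>C \<pi> x) \<and>
    (\<forall>x y. \<pi> (x * y) = \<pi> x * \<pi> y) \<and> (\<forall>x. \<pi> (star x) = star (\<pi> x)) \<and> \<pi> 1 = 1"

definition star_automorphism :: "('a::unital_cstar_algebra \<Rightarrow> 'a) \<Rightarrow> bool"
  where "star_automorphism \<beta> \<longleftrightarrow> unital_star_hom \<beta> \<and> bij \<beta>"

definition unital_star_subalgebra :: "'a::unital_cstar_algebra set \<Rightarrow> bool"
  where "unital_star_subalgebra S \<longleftrightarrow> 1 \<in> S \<and>
    (\<forall>x\<in>S. \<forall>y\<in>S. x + y \<in> S \<and> x * y \<in> S) \<and> (\<forall>c. \<forall>x\<in>S. c *\<^sub>C x \<in> S) \<and> (\<forall>x\<in>S. star x \<in> S)"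

definition generated_cstar_subalgebra :: "'a::unital_cstar_algebra set \<Rightarrow> 'a set"
  where "generated_cstar_subalgebra M = \<Inter> {S. M \<subseteq> S \<and> unital_star_subalgebra S \<and> closed S}"

definition unitary :: "'a::unital_cstar_algebra \<Rightarrow> bool"
  where "unitary v \<longleftrightarrow> star v * v = 1 \<and> v * star v = 1"

text \<open>
  States. A positive element is one of the form $x^*x$; unital positive functionals
  automatically have norm one.
\<close>

definition state :: "('a::unital_cstar_algebra \<Rightarrow> complex) \<Rightarrow> bool"
  where "state \<phi> \<longleftrightarrow>
    (\<forall>x y. \<phi> (x + y) = \<phi> x + \<phi> y) \<and> (\<forall>c x. \<phi> (c *\<^sub>C x) = c * \<phi> x) \<and>
    (\<forall>x. \<phi> (star x * x) \<in> \<real> \<and> 0 \<le> Re (\<phi> (star x * x))) \<and> \<phi> 1 = 1"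

section \<open>Locally compact groups and $C^*$-dynamical systems\<close>

text \<open>
  Groups are written additively because the library has topological group classes only in this
  notation; \<^class>\<open>group_add\<close> is not assumed to be commutative. Thus \<open>g + h\<close> is the product $gh$.
\<close>

text \<open>
  On a second countable locally compact Hausdorff space, Borel measures that are finite on compact
  sets are automatically regular.
\<close>

definition left_haar_measure :: "'g::topological_group_add measure \<Rightarrow> bool"
  where "left_haar_measure \<mu> \<longleftrightarrow>
    sets \<mu> = sets borel \<and> emeasure \<mu> UNIV \<noteq> 0 \<and> (\<forall>K. compact K \<longrightarrow> emeasure \<mu> K < \<infinity>) \<and>
    (\<forall>g. \<forall>A\<in>sets borel. emeasure \<mu> ((\<lambda>x. g + x) ` A) = emeasure \<mu> A)"

definition unimodular_group :: "'g::topological_group_add itself \<Rightarrow> bool"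
  where "unimodular_group _ \<longleftrightarrow> (\<exists>\<mu> :: 'g measure. left_haar_measure \<mu> \<and>
    (\<forall>g. \<forall>A\<in>sets borel. emeasure \<mu> ((\<lambda>x. x + g) ` A) = emeasure \<mu> A))"

text \<open>
  Amenability is the existence of a left invariant mean on $L^\infty(G)$. The mean is
  given on (real) essentially bounded Borel functions; by \<open>AE\<close>-positivity it only depends on
  classes modulo null functions.
\<close>

definition essentially_bounded :: "'g::topological_space measure \<Rightarrow> ('g \<Rightarrow> real) set"
  where "essentially_bounded \<mu> = {f \<in> borel_measurable borel. \<exists>C. AE x in \<mu>. \<bar>f x\<bar> \<le> C}"

definition left_invariant_mean ::
    "'g::topological_group_add measure \<Rightarrow> (('g \<Rightarrow> real) \<Rightarrow> real) \<Rightarrow> bool"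
  where "left_invariant_mean \<mu> m \<longleftrightarrow>
    (\<forall>f\<in>essentially_bounded \<mu>. \<forall>h\<in>essentially_bounded \<mu>. m (\<lambda>x. f x + h x) = m f + m h) \<and>
    (\<forall>c. \<forall>f\<in>essentially_bounded \<mu>. m (\<lambda>x. c * f x) = c * m f) \<and>
    (\<forall>f\<in>essentially_bounded \<mu>. (AE x in \<mu>. 0 \<le> f x) \<longrightarrow> 0 \<le> m f) \<and>
    m (\<lambda>x. 1) = 1 \<and>
    (\<forall>g. \<forall>f\<in>essentially_bounded \<mu>. m (\<lambda>x. f (g + x)) = m f)"

definition amenable_group :: "'g::topological_group_add itself \<Rightarrow> bool"
  where "amenable_group _ \<longleftrightarrow>
    (\<exists>\<mu> :: 'g measure. left_haar_measure \<mu> \<and> (\<exists>m. left_invariant_mean \<mu> m))"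

definition cstar_dynamical_system ::
    "('g::topological_group_add \<Rightarrow> 'b::unital_cstar_algebra \<Rightarrow> 'b) \<Rightarrow> bool"
  where "cstar_dynamical_system \<beta> \<longleftrightarrow>
    (\<forall>g. star_automorphism (\<beta> g)) \<and> (\<forall>g h. \<beta> (g + h) = \<beta> g \<circ> \<beta> h) \<and>
    (\<forall>b. continuous_on UNIV (\<lambda>g. \<beta> g b))"

definition uniquely_ergodic :: "('g \<Rightarrow> 'b::unital_cstar_algebra \<Rightarrow> 'b) \<Rightarrow> bool"
  where "uniquely_ergodic \<beta> \<longleftrightarrow> (\<exists>!\<phi>. state \<phi> \<and> (\<forall>g. \<phi> \<circ> \<beta> g = \<phi>))"

definition fixed_points :: "('g \<Rightarrow> 'b::unital_cstar_algebra \<Rightarrow> 'b) \<Rightarrow> 'b set"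
  where "fixed_points \<beta> = {b. \<forall>g. \<beta> g b = b}"

definition weakly_ergodic :: "('g \<Rightarrow> 'b::unital_cstar_algebra \<Rightarrow> 'b) \<Rightarrow> bool"
  where "weakly_ergodic \<beta> \<longleftrightarrow> fixed_points \<beta> = range (\<lambda>c. c *\<^sub>C 1)"

definition continuous_cocycle ::
    "('g::topological_group_add \<Rightarrow> ('x::metric_space \<Rightarrow>\<^sub>C complex) \<Rightarrow> ('x \<Rightarrow>\<^sub>C complex)) \<Rightarrow>
      ('g \<Rightarrow> ('x \<Rightarrow>\<^sub>C complex)) \<Rightarrow> bool"
  where "continuous_cocycle \<theta> u \<longleftrightarrow>
    continuous_on UNIV (\<lambda>(g, x). apply_bcontfun (u g) x) \<and>
    (\<forall>g x. cmod (apply_bcontfun (u g) x) = 1) \<and>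
    (\<forall>g h. u (g + h) = \<theta> g (u h) * u g)"

section \<open>Crossed products by $\mathbb Z$\<close>

text \<open>
  The algebraic crossed product consists of the finitely supported functions \<open>f :: int \<Rightarrow> 'a\<close>,
  where \<open>f\<close> stands for $\sum_n f(n) V^n$ and \<open>V\<close> implements \<open>\<alpha>\<close>.
\<close>

definition int_funpow :: "('a \<Rightarrow> 'a) \<Rightarrow> int \<Rightarrow> 'a \<Rightarrow> 'a"
  where "int_funpow \<alpha> n = (if 0 \<le> n then \<alpha> ^^ nat n else inv \<alpha> ^^ nat (- n))"

definition unitary_power :: "'a::unital_cstar_algebra \<Rightarrow> int \<Rightarrow> 'a"
  where "unitary_power v n = (if 0 \<le> n then v ^ nat n else star v ^ nat (- n))"

definition finitely_supported :: "(int \<Rightarrow> 'a::zero) \<Rightarrow> bool"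
  where "finitely_supported f \<longleftrightarrow> finite {n. f n \<noteq> 0}"

definition twisted_mult ::
    "('a \<Rightarrow> 'a) \<Rightarrow> (int \<Rightarrow> 'a) \<Rightarrow> (int \<Rightarrow> 'a) \<Rightarrow> (int \<Rightarrow> 'a::unital_cstar_algebra)"
  where "twisted_mult \<alpha> f g = (\<lambda>n. \<Sum>k | f k \<noteq> 0. f k * int_funpow \<alpha> k (g (n - k)))"

definition twisted_star :: "('a \<Rightarrow> 'a) \<Rightarrow> (int \<Rightarrow> 'a) \<Rightarrow> (int \<Rightarrow> 'a::unital_cstar_algebra)"
  where "twisted_star \<alpha> f = (\<lambda>n. int_funpow \<alpha> n (star (f (- n))))"

definition cstar_seminorm ::
    "('a::unital_cstar_algebra \<Rightarrow> 'a) \<Rightarrow> ((int \<Rightarrow> 'a) \<Rightarrow> real) \<Rightarrow> bool"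
  where "cstar_seminorm \<alpha> p \<longleftrightarrow>
    (\<forall>f g. finitely_supported f \<longrightarrow> finitely_supported g \<longrightarrow>
      p (\<lambda>n. f n + g n) \<le> p f + p g \<and> p (twisted_mult \<alpha> f g) \<le> p f * p g) \<and>
    (\<forall>c f. finitely_supported f \<longrightarrow> p (\<lambda>n. c *\<^sub>C f n) = cmod c * p f) \<and>
    (\<forall>f. finitely_supported f \<longrightarrow> p (twisted_mult \<alpha> (twisted_star \<alpha> f) f) = (p f)\<^sup>2)"

definition covariant_pair ::
    "('a \<Rightarrow> 'a) \<Rightarrow> ('a::unital_cstar_algebra \<Rightarrow> 'd::unital_cstar_algebra) \<Rightarrow> 'd \<Rightarrow> bool"
  where "covariant_pair \<alpha> \<pi> W \<longleftrightarrow>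
    unital_star_hom \<pi> \<and> unitary W \<and> (\<forall>a. W * \<pi> a * star W = \<pi> (\<alpha> a))"

definition integrated_form ::
    "('a \<Rightarrow> 'd) \<Rightarrow> 'd \<Rightarrow> (int \<Rightarrow> 'a::unital_cstar_algebra) \<Rightarrow> 'd::unital_cstar_algebra"
  where "integrated_form \<pi> W f = (\<Sum>n | f n \<noteq> 0. \<pi> (f n) * unitary_power W n)"

text \<open>
  \<open>universal_crossed_product \<alpha> \<iota> V\<close>: the $C^*$-algebra given by the type \<open>'b\<close> is the universal
  crossed product of \<open>'a\<close> by \<open>\<alpha>\<close>, with \<open>\<iota>\<close> the inclusion of \<open>'a\<close> and \<open>V\<close> the implementing
  unitary. The last clause says that the norm restricts to the universal (i.e. largest
  $C^*$-semi-)norm of the algebraic crossed product. Stating universality through the norm avoids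
  a quantification over all target $C^*$-algebras, i.e. over types; the mapping property for
  targets of arbitrary type is lemma \<open>universal_crossed_product_hom\<close> below.
\<close>

definition universal_crossed_product ::
    "('a \<Rightarrow> 'a) \<Rightarrow> ('a::unital_cstar_algebra \<Rightarrow> 'b::unital_cstar_algebra) \<Rightarrow> 'b \<Rightarrow> bool"
  where "universal_crossed_product \<alpha> \<iota> V \<longleftrightarrow>
    covariant_pair \<alpha> \<iota> V \<and> inj \<iota> \<and>
    generated_cstar_subalgebra (range \<iota> \<union> {V}) = UNIV \<and>
    (\<forall>p f. cstar_seminorm \<alpha> p \<longrightarrow> finitely_supported f \<longrightarrow> p f \<le> norm (integrated_form \<iota> V f))"

lemma unital_star_homD:
  assumes "unital_star_hom \<pi>"
  shows "\<pi> (x + y) = \<pi> x + \<pi> y" "\<pi> (c *\<^sub>C x) = c *\<^sub>C \<pi> x" "\<pi> (x * y) = \<pi> x * \<pi> y"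
    "\<pi> (star x) = star (\<pi> x)" "\<pi> 1 = 1" "\<pi> 0 = 0" "\<pi> (sum h A) = (\<Sum>i\<in>A. \<pi> (h i))"
proof -
  show add: "\<pi> (x + y) = \<pi> x + \<pi> y" for x y
    using assms by (simp add: unital_star_hom_def)
  show zero: "\<pi> 0 = 0"
    using add[of 0 0] by simp
  show "\<pi> (sum h A) = (\<Sum>i\<in>A. \<pi> (h i))"
    by (induction A rule: infinite_finite_induct) (simp_all add: add zero)
qed (use assms in \<open>simp_all add: unital_star_hom_def\<close>)

lemma star_automorphism_inv:
  assumes "star_automorphism \<alpha>"
  shows "star_automorphism (inv \<alpha>)"
proof -
  have b: "bij \<alpha>" and h: "unital_star_hom \<alpha>"
    using assms by (auto simp: star_automorphism_def)
  have eq: "inv \<alpha> y = x \<longleftrightarrow> y = \<alpha> x" for x y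
    using b by (metis bij_inv_eq_iff)
  have sv: "\<alpha> (inv \<alpha> y) = y" for y
    using eq by metis
  have "unital_star_hom (inv \<alpha>)"
    unfolding unital_star_hom_def eq by (simp add: unital_star_homD[OF h] sv)
  with b show ?thesis by (simp add: star_automorphism_def bij_imp_bij_inv)
qed

lemma unital_star_hom_int_funpow:
  assumes "star_automorphism \<alpha>"
  shows "unital_star_hom (int_funpow \<alpha> n)"
proof -
  have pow: "unital_star_hom (\<gamma> ^^ k)" if "unital_star_hom \<gamma>" for \<gamma> :: "'a \<Rightarrow> 'a" and k
    by (induction k) (use that in \<open>simp_all add: unital_star_hom_def\<close>)
  have "unital_star_hom (\<alpha> ^^ k)" "unital_star_hom (inv \<alpha> ^^ k)" for k
    using assms star_automorphism_inv[OF assms] by (auto intro!: pow simp: star_automorphism_def)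
  then show ?thesis
    by (cases "0 \<le> n") (simp_all add: int_funpow_def[abs_def])
qed

lemma int_funpow_add:
  assumes "bij \<alpha>"
  shows "int_funpow \<alpha> (m + n) x = int_funpow \<alpha> m (int_funpow \<alpha> n x)"
proof -
  have i: "inv \<alpha> (\<alpha> y) = y" "\<alpha> (inv \<alpha> y) = y" for y
    using assms by (simp_all add: bij_is_inj bij_is_surj surj_f_inv_f)
  have suc: "int_funpow \<alpha> (n + 1) x = \<alpha> (int_funpow \<alpha> n x)" for n x
  proof (cases "0 \<le> n")
    case True
    then show ?thesis by (simp add: int_funpow_def nat_add_distrib)
  next
    case False
    then have "nat (- n) = Suc (nat (- (n + 1)))" by simp
    with False show ?thesis by (auto simp: int_funpow_def i)
  qed
  have pred: "int_funpow \<alpha> (n - 1) x = inv \<alpha> (int_funpow \<alpha> n x)" for n x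
    using suc[of "n - 1" x] by (simp add: i)
  show ?thesis
  proof (induction m rule: int_induct[where k = 0])
    case base
    then show ?case by (simp add: int_funpow_def)
  next
    case (step1 m)
    then show ?case using suc[of "m + n" x] suc[of m] by (simp add: algebra_simps)
  next
    case (step2 m)
    then show ?case using pred[of "m + n" x] pred[of m] by (simp add: algebra_simps)
  qed
qed

lemma unitary_power_add:
  assumes "unitary v"
  shows "unitary_power v (m + n) = unitary_power v m * unitary_power v n"
proof -
  have i: "star v * (v * y) = y" "v * (star v * y) = y" for y
    using assms by (simp_all add: unitary_def mult.assoc[symmetric])
  have suc: "unitary_power v (n + 1) = v * unitary_power v n" for n
  proof (cases "0 \<le> n")
    case True
    then show ?thesis by (simp add: unitary_power_def nat_add_distrib)
  next
    case False
    then have "nat (- n) = Suc (nat (- (n + 1)))" by simp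
    with False show ?thesis by (auto simp: unitary_power_def i)
  qed
  have pred: "unitary_power v (n - 1) = star v * unitary_power v n" for n
    using suc[of "n - 1"] by (simp add: i)
  show ?thesis
  proof (induction m rule: int_induct[where k = 0])
    case base
    then show ?case by (simp add: unitary_power_def)
  next
    case (step1 m)
    then show ?case using suc[of "m + n"] suc[of m] by (simp add: algebra_simps)
  next
    case (step2 m)
    then show ?case using pred[of "m + n"] pred[of m] by (simp add: algebra_simps)
  qed
qed

lemma unitary_power_simps [simp]: "unitary_power v 0 = 1" "unitary_power v 1 = v"
  by (simp_all add: unitary_power_def)

lemma star_unitary_power: "star (unitary_power v n) = unitary_power v (- n)"
proof -
  have "star (x ^ k) = star x ^ k" for x :: 'a and k
    by (induction k) (simp_all add: star_mult power_commutes)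
  then show ?thesis by (auto simp: unitary_power_def star_star)
qed

lemma covariant_pair_power:
  assumes "star_automorphism \<alpha>" "covariant_pair \<alpha> \<pi> W"
  shows "unitary_power W n * \<pi> a = \<pi> (int_funpow \<alpha> n a) * unitary_power W n"
proof -
  have W: "unitary W" and c: "W * \<pi> a * star W = \<pi> (\<alpha> a)" for a
    using assms(2) by (auto simp: covariant_pair_def)
  have b: "bij \<alpha>" using assms(1) by (simp add: star_automorphism_def)
  have up: "W * \<pi> a = \<pi> (\<alpha> a) * W" for a
    using W by (simp add: c[symmetric] mult.assoc unitary_def)
  have down: "star W * \<pi> a = \<pi> (inv \<alpha> a) * star W" for a
  proof -
    have "\<pi> a = W * \<pi> (inv \<alpha> a) * star W"
      using b by (simp add: c bij_is_surj surj_f_inv_f)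
    then have "star W * \<pi> a = (star W * W) * \<pi> (inv \<alpha> a) * star W"
      by (simp only: mult.assoc)
    with W show ?thesis by (simp add: unitary_def)
  qed
  have pow: "x ^ k * \<pi> a = \<pi> ((\<gamma> ^^ k) a) * x ^ k" if "\<And>a. x * \<pi> a = \<pi> (\<gamma> a) * x" for x \<gamma> k a
    by (induction k arbitrary: a) (simp_all add: mult.assoc, metis mult.assoc that)
  show ?thesis
    using pow[of W \<alpha>, OF up] pow[of "star W" "inv \<alpha>", OF down]
    by (simp add: unitary_power_def int_funpow_def)
qed

lemma integrated_form_superset:
  assumes "unital_star_hom \<pi>" "finite A" "{n. f n \<noteq> 0} \<subseteq> A"
  shows "integrated_form \<pi> W f = (\<Sum>n\<in>A. \<pi> (f n) * unitary_power W n)"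
  unfolding integrated_form_def
  by (rule sum.mono_neutral_left) (use assms in \<open>auto simp: unital_star_homD\<close>)

lemma
  assumes f: "finitely_supported f" and g: "finitely_supported g"
  shows finitely_supported_add: "finitely_supported (\<lambda>n. f n + g n :: 'a::unital_cstar_algebra)"
    and integrated_form_add: "unital_star_hom \<pi> \<Longrightarrow>
      integrated_form \<pi> W (\<lambda>n. f n + g n) = integrated_form \<pi> W f + integrated_form \<pi> W g"
proof -
  let ?A = "{n. f n \<noteq> 0} \<union> {n. g n \<noteq> 0}"
  have A: "finite ?A" using f g by (simp add: finitely_supported_def)
  have sub: "{n. f n + g n \<noteq> 0} \<subseteq> ?A" by auto
  show "finitely_supported (\<lambda>n. f n + g n)"
    unfolding finitely_supported_def using A sub by (rule finite_subset[rotated])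
  assume \<pi>: "unital_star_hom \<pi>"
  show "integrated_form \<pi> W (\<lambda>n. f n + g n) = integrated_form \<pi> W f + integrated_form \<pi> W g"
    by (simp add: integrated_form_superset[OF \<pi> A] sub unital_star_homD[OF \<pi>] distrib_right
        sum.distrib)
qed

lemma
  assumes f: "finitely_supported f"
  shows finitely_supported_scaleC: "finitely_supported (\<lambda>n. c *\<^sub>C f n)"
    and integrated_form_scaleC: "unital_star_hom \<pi> \<Longrightarrow>
      integrated_form \<pi> W (\<lambda>n. c *\<^sub>C f n) = c *\<^sub>C integrated_form \<pi> W f"
proof -
  let ?A = "{n. f n \<noteq> 0}"
  have A: "finite ?A" using f by (simp add: finitely_supported_def)
  have sub: "{n. c *\<^sub>C f n \<noteq> 0} \<subseteq> ?A" by auto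
  show "finitely_supported (\<lambda>n. c *\<^sub>C f n)"
    unfolding finitely_supported_def using A sub by (rule finite_subset[rotated])
  assume \<pi>: "unital_star_hom \<pi>"
  show "integrated_form \<pi> W (\<lambda>n. c *\<^sub>C f n) = c *\<^sub>C integrated_form \<pi> W f"
    by (simp add: integrated_form_superset[OF \<pi> A] sub unital_star_homD[OF \<pi>] mult_scaleC_left
        scaleC_sum)
qed

lemma
  assumes \<alpha>: "star_automorphism \<alpha>" and f: "finitely_supported f"
  shows finitely_supported_twisted_star: "finitely_supported (twisted_star \<alpha> f)"
    and integrated_form_twisted_star: "covariant_pair \<alpha> \<pi> W \<Longrightarrow>
      integrated_form \<pi> W (twisted_star \<alpha> f) = star (integrated_form \<pi> W f)"
proof -
  note h = unital_star_homD[OF unital_star_hom_int_funpow[OF \<alpha>]]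
  let ?A = "{n. f n \<noteq> 0}"
  have A: "finite ?A" using f by (simp add: finitely_supported_def)
  have A': "finite (uminus ` ?A)" using A by simp
  have sub: "{n. twisted_star \<alpha> f n \<noteq> 0} \<subseteq> uminus ` ?A"
  proof
    fix n assume "n \<in> {n. twisted_star \<alpha> f n \<noteq> 0}"
    then have "- n \<in> ?A" by (auto simp: twisted_star_def h)
    then show "n \<in> uminus ` ?A" by (metis image_eqI minus_minus)
  qed
  show "finitely_supported (twisted_star \<alpha> f)"
    unfolding finitely_supported_def using A' sub by (rule finite_subset[rotated])
  assume cov: "covariant_pair \<alpha> \<pi> W"
  then have \<pi>: "unital_star_hom \<pi>" by (simp add: covariant_pair_def)
  have "integrated_form \<pi> W (twisted_star \<alpha> f) =
      (\<Sum>n\<in>?A. \<pi> (int_funpow \<alpha> (- n) (star (f n))) * unitary_power W (- n))"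
    unfolding integrated_form_superset[OF \<pi> A' sub]
    by (simp add: sum.reindex twisted_star_def)
  also have "\<dots> = (\<Sum>n\<in>?A. star (\<pi> (f n) * unitary_power W n))"
    by (simp add: covariant_pair_power[OF \<alpha> cov, symmetric] star_mult star_unitary_power
        unital_star_homD[OF \<pi>])
  also have "\<dots> = star (integrated_form \<pi> W f)"
    by (simp add: integrated_form_def star_sum)
  finally show "integrated_form \<pi> W (twisted_star \<alpha> f) = star (integrated_form \<pi> W f)" .
qed

lemma
  assumes \<alpha>: "star_automorphism \<alpha>" and f: "finitely_supported f" and g: "finitely_supported g"
  shows finitely_supported_twisted_mult: "finitely_supported (twisted_mult \<alpha> f g)"
    and integrated_form_twisted_mult: "covariant_pair \<alpha> \<pi> W \<Longrightarrow>
      integrated_form \<pi> W (twisted_mult \<alpha> f g) = integrated_form \<pi> W f * integrated_form \<pi> W g"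
proof -
  note h = unital_star_homD[OF unital_star_hom_int_funpow[OF \<alpha>]]
  let ?F = "{n. f n \<noteq> 0}" and ?G = "{n. g n \<noteq> 0}"
  let ?N = "\<Union>k\<in>?F. (+) k ` ?G"
  have F: "finite ?F" and G: "finite ?G" using f g by (simp_all add: finitely_supported_def)
  have N: "finite ?N" using F G by simp
  have mem: "n \<in> (+) k ` ?G" if "g (n - k) \<noteq> 0" for n k
    using that by (intro image_eqI[of _ _ "n - k"]) auto
  have sub: "{n. twisted_mult \<alpha> f g n \<noteq> 0} \<subseteq> ?N"
  proof
    fix n assume "n \<in> {n. twisted_mult \<alpha> f g n \<noteq> 0}"
    then have "(\<Sum>k\<in>?F. f k * int_funpow \<alpha> k (g (n - k))) \<noteq> 0"
      by (simp add: twisted_mult_def)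
    then obtain k where k: "k \<in> ?F" "f k * int_funpow \<alpha> k (g (n - k)) \<noteq> 0"
      by (rule sum.not_neutral_contains_not_neutral)
    then have "g (n - k) \<noteq> 0" using h(6)[of k] by auto
    with k(1) show "n \<in> ?N" using mem by blast
  qed
  show "finitely_supported (twisted_mult \<alpha> f g)"
    unfolding finitely_supported_def using N sub by (rule finite_subset[rotated])
  assume cov: "covariant_pair \<alpha> \<pi> W"
  then have \<pi>: "unital_star_hom \<pi>" and W: "unitary W" by (simp_all add: covariant_pair_def)
  have "integrated_form \<pi> W (twisted_mult \<alpha> f g) =
      (\<Sum>n\<in>?N. \<Sum>k\<in>?F. \<pi> (f k * int_funpow \<alpha> k (g (n - k))) * unitary_power W n)"
    unfolding integrated_form_superset[OF \<pi> N sub]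
    by (simp only: twisted_mult_def unital_star_homD(7)[OF \<pi>] sum_distrib_right)
  also have "\<dots> = (\<Sum>k\<in>?F. \<Sum>n\<in>?N. \<pi> (f k * int_funpow \<alpha> k (g (n - k))) * unitary_power W n)"
    by (rule sum.swap)
  also have "\<dots> =
      (\<Sum>k\<in>?F. \<Sum>l\<in>?G. (\<pi> (f k) * unitary_power W k) * (\<pi> (g l) * unitary_power W l))"
  proof (rule sum.cong[OF refl])
    fix k assume k: "k \<in> ?F"
    have "(\<Sum>n\<in>?N. \<pi> (f k * int_funpow \<alpha> k (g (n - k))) * unitary_power W n) =
        (\<Sum>n\<in>(+) k ` ?G. \<pi> (f k * int_funpow \<alpha> k (g (n - k))) * unitary_power W n)"
    proof (rule sum.mono_neutral_right[OF N])
      show "(+) k ` ?G \<subseteq> ?N" using k by blast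
      show "\<forall>n\<in>?N - (+) k ` ?G. \<pi> (f k * int_funpow \<alpha> k (g (n - k))) * unitary_power W n = 0"
      proof
        fix n assume "n \<in> ?N - (+) k ` ?G"
        then have "g (n - k) = 0" using mem by blast
        then show "\<pi> (f k * int_funpow \<alpha> k (g (n - k))) * unitary_power W n = 0"
          by (simp add: h(6) unital_star_homD(6)[OF \<pi>])
      qed
    qed
    also have "\<dots> = (\<Sum>l\<in>?G. \<pi> (f k * int_funpow \<alpha> k (g l)) * unitary_power W (k + l))"
      by (simp add: sum.reindex)
    also have "\<dots> = (\<Sum>l\<in>?G. (\<pi> (f k) * unitary_power W k) * (\<pi> (g l) * unitary_power W l))"
    proof (rule sum.cong[OF refl])
      fix l
      have "\<pi> (f k * int_funpow \<alpha> k (g l)) * unitary_power W (k + l) =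
          \<pi> (f k) * (\<pi> (int_funpow \<alpha> k (g l)) * unitary_power W k) * unitary_power W l"
        by (simp add: unital_star_homD[OF \<pi>] unitary_power_add[OF W] mult.assoc)
      also have "\<dots> = (\<pi> (f k) * unitary_power W k) * (\<pi> (g l) * unitary_power W l)"
        unfolding covariant_pair_power[OF \<alpha> cov, symmetric] by (simp add: mult.assoc)
      finally show "\<pi> (f k * int_funpow \<alpha> k (g l)) * unitary_power W (k + l) =
          (\<pi> (f k) * unitary_power W k) * (\<pi> (g l) * unitary_power W l)" .
    qed
    finally show "(\<Sum>n\<in>?N. \<pi> (f k * int_funpow \<alpha> k (g (n - k))) * unitary_power W n) =
        (\<Sum>l\<in>?G. (\<pi> (f k) * unitary_power W k) * (\<pi> (g l) * unitary_power W l))" .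
  qed
  also have "\<dots> = integrated_form \<pi> W f * integrated_form \<pi> W g"
    by (simp add: integrated_form_def sum_product)
  finally show "integrated_form \<pi> W (twisted_mult \<alpha> f g) =
      integrated_form \<pi> W f * integrated_form \<pi> W g" .
qed

lemma cstar_seminorm_covariant_pair:
  assumes \<alpha>: "star_automorphism \<alpha>" and cov: "covariant_pair \<alpha> \<pi> W"
  shows "cstar_seminorm \<alpha> (\<lambda>f. norm (integrated_form \<pi> W f))"
proof -
  have \<pi>: "unital_star_hom \<pi>" using cov by (simp add: covariant_pair_def)
  show ?thesis
    unfolding cstar_seminorm_def
  proof (intro conjI allI impI)
    fix f g :: "int \<Rightarrow> 'a" and c
    assume f: "finitely_supported f"
    show "norm (integrated_form \<pi> W (\<lambda>n. c *\<^sub>C f n)) = cmod c * norm (integrated_form \<pi> W f)"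
      by (simp only: integrated_form_scaleC[OF f \<pi>] norm_scaleC)
    show "norm (integrated_form \<pi> W (twisted_mult \<alpha> (twisted_star \<alpha> f) f)) =
        (norm (integrated_form \<pi> W f))\<^sup>2"
      by (simp only: integrated_form_twisted_star[OF \<alpha> f cov] norm_star_mult_self
          integrated_form_twisted_mult[OF \<alpha> finitely_supported_twisted_star[OF \<alpha> f] f cov])
    assume g: "finitely_supported g"
    show "norm (integrated_form \<pi> W (\<lambda>n. f n + g n)) \<le>
        norm (integrated_form \<pi> W f) + norm (integrated_form \<pi> W g)"
      by (simp only: integrated_form_add[OF f g \<pi>] norm_triangle_ineq)
    show "norm (integrated_form \<pi> W (twisted_mult \<alpha> f g)) \<le>
        norm (integrated_form \<pi> W f) * norm (integrated_form \<pi> W g)"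
      by (simp only: integrated_form_twisted_mult[OF \<alpha> f g cov] norm_mult_ineq)
  qed
qed

lemma integrated_form_single:
  assumes "unital_star_hom \<pi>"
  shows "integrated_form \<pi> W (\<lambda>n. if n = k then a else 0) = \<pi> a * unitary_power W k"
    and "finitely_supported (\<lambda>n::int. if n = k then a else 0)"
proof -
  have *: "{n. (if n = k then a else 0) \<noteq> 0} \<subseteq> {k}" by auto
  then show "finitely_supported (\<lambda>n. if n = k then a else 0)"
    unfolding finitely_supported_def by (rule finite_subset) simp
  show "integrated_form \<pi> W (\<lambda>n. if n = k then a else 0) = \<pi> a * unitary_power W k"
    by (subst integrated_form_superset[OF assms _ *]) simp_all
qed

lemma closure_star_subalgebra:
  assumes "unital_star_subalgebra (S :: 'a::unital_cstar_algebra set)"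
  shows "unital_star_subalgebra (closure S)"
proof -
  have clos: "f z \<in> closure S"
    if "continuous_on UNIV f" "\<And>w. w \<in> T \<Longrightarrow> f w \<in> S" "z \<in> closure T"
    for f :: "'c::topological_space \<Rightarrow> 'a" and T z
  proof -
    have "f ` closure T \<subseteq> closure S"
      by (rule image_closure_subset)
        (use that closure_subset[of S] in \<open>auto intro: continuous_on_subset\<close>)
    with that show ?thesis by blast
  qed
  have c2: "continuous_on UNIV (\<lambda>z. fst z + snd z :: 'a)" "continuous_on UNIV (\<lambda>z. fst z * snd z :: 'a)"
    by (intro continuous_intros)+
  have add: "x + y \<in> closure S" and mul: "x * y \<in> closure S"
    if "x \<in> closure S" "y \<in> closure S" for x y
    using clos[OF c2(1), of "S \<times> S" "(x, y)"] clos[OF c2(2), of "S \<times> S" "(x, y)"] that assms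
    by (auto simp: closure_Times unital_star_subalgebra_def)
  have sc: "c *\<^sub>C x \<in> closure S" and st: "star x \<in> closure S" if "x \<in> closure S" for c x
    using clos[OF continuous_on_scaleC[OF continuous_on_id], of S c x]
      clos[OF continuous_on_star[OF continuous_on_id], of S x] that assms
    by (auto simp: unital_star_subalgebra_def)
  have "1 \<in> closure S" using assms closure_subset[of S] by (auto simp: unital_star_subalgebra_def)
  with add mul sc st show ?thesis by (simp add: unital_star_subalgebra_def)
qed

lemma universal_crossed_product_dense:
  assumes \<alpha>: "star_automorphism \<alpha>" and univ: "universal_crossed_product \<alpha> \<iota> V"
  shows "closure (integrated_form \<iota> V ` {f. finitely_supported f}) = UNIV"
proof -
  let ?D = "integrated_form \<iota> V ` {f. finitely_supported f}"
  have cov: "covariant_pair \<alpha> \<iota> V" and gen: "generated_cstar_subalgebra (range \<iota> \<union> {V}) = UNIV"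
    using univ by (simp_all add: universal_crossed_product_def)
  have \<iota>: "unital_star_hom \<iota>" using cov by (simp add: covariant_pair_def)
  have base: "\<iota> a * unitary_power V k \<in> ?D" for a k
    using integrated_form_single[OF \<iota>] by (metis imageI mem_Collect_eq)
  have ran: "\<iota> a \<in> ?D" for a using base[of a 0] by simp
  have "V \<in> ?D" using base[of 1 1] by (simp add: unital_star_homD[OF \<iota>])
  moreover have "unital_star_subalgebra ?D"
    unfolding unital_star_subalgebra_def
  proof (intro conjI ballI allI)
    show "1 \<in> ?D" using ran[of 1] by (simp add: unital_star_homD[OF \<iota>])
  next
    fix x y assume "x \<in> ?D" "y \<in> ?D"
    then obtain f g where "finitely_supported f" "finitely_supported g"
      "x = integrated_form \<iota> V f" "y = integrated_form \<iota> V g" by auto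
    then show "x + y \<in> ?D" "x * y \<in> ?D"
      by (auto simp: integrated_form_add[symmetric] \<iota> integrated_form_twisted_mult[OF \<alpha> _ _ cov, symmetric]
          intro!: imageI finitely_supported_add finitely_supported_twisted_mult[OF \<alpha>])
  next
    fix c x assume "x \<in> ?D"
    then show "c *\<^sub>C x \<in> ?D" "star x \<in> ?D"
      by (auto simp: integrated_form_scaleC[symmetric] \<iota> integrated_form_twisted_star[OF \<alpha> _ cov, symmetric]
          intro!: imageI finitely_supported_scaleC finitely_supported_twisted_star[OF \<alpha>])
  qed
  ultimately have "generated_cstar_subalgebra (range \<iota> \<union> {V}) \<subseteq> closure ?D"
    unfolding generated_cstar_subalgebra_def using ran closure_subset[of ?D]
    by (intro Inter_lower) (auto intro!: closure_star_subalgebra)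
  with gen show ?thesis by auto
qed

theorem universal_crossed_product_hom:
  fixes \<pi> :: "'a::unital_cstar_algebra \<Rightarrow> 'd::unital_cstar_algebra"
    and \<iota> :: "'a \<Rightarrow> 'b::unital_cstar_algebra"
  assumes \<alpha>: "star_automorphism \<alpha>" and univ: "universal_crossed_product \<alpha> \<iota> V"
    and cov: "covariant_pair \<alpha> \<pi> W"
  shows "\<exists>!\<rho>. unital_star_hom \<rho> \<and> continuous_on UNIV \<rho> \<and> (\<forall>a. \<rho> (\<iota> a) = \<pi> a) \<and> \<rho> V = W"
proof -
  let ?D = "integrated_form \<iota> V ` {f. finitely_supported f}"
  have cov': "covariant_pair \<alpha> \<iota> V"
    and max: "\<And>p f. cstar_seminorm \<alpha> p \<Longrightarrow> finitely_supported f \<Longrightarrow>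
      p f \<le> norm (integrated_form \<iota> V f)"
    using univ by (simp_all add: universal_crossed_product_def)
  have \<pi>: "unital_star_hom \<pi>" and \<iota>: "unital_star_hom \<iota>"
    using cov cov' by (simp_all add: covariant_pair_def)
  have dense: "closure ?D = UNIV" by (rule universal_crossed_product_dense[OF \<alpha> univ])
  have le: "norm (integrated_form \<pi> W f - integrated_form \<pi> W g) \<le>
      norm (integrated_form \<iota> V f - integrated_form \<iota> V g)"
    if "finitely_supported f" "finitely_supported g" for f g
  proof -
    let ?h = "\<lambda>n. f n + (-1) *\<^sub>C g n"
    have "finitely_supported ?h"
      using that by (intro finitely_supported_add finitely_supported_scaleC)
    note max[OF cstar_seminorm_covariant_pair[OF \<alpha> cov] this]
    then show ?thesis
      unfolding integrated_form_add[OF that(1) finitely_supported_scaleC[OF that(2)] \<pi>]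
        integrated_form_add[OF that(1) finitely_supported_scaleC[OF that(2)] \<iota>]
        integrated_form_scaleC[OF that(2) \<pi>] integrated_form_scaleC[OF that(2) \<iota>]
      by (simp add: scaleC_minus_one)
  qed
  define r where
    "r b = integrated_form \<pi> W (SOME f. finitely_supported f \<and> integrated_form \<iota> V f = b)" for b
  have r: "r (integrated_form \<iota> V f) = integrated_form \<pi> W f" if "finitely_supported f" for f
  proof -
    let ?g = "SOME g. finitely_supported g \<and> integrated_form \<iota> V g = integrated_form \<iota> V f"
    have "finitely_supported ?g \<and> integrated_form \<iota> V ?g = integrated_form \<iota> V f"
      by (rule someI[of _ f]) (use that in simp)
    then show ?thesis using le[of ?g f] that by (simp add: r_def)
  qed
  have "uniformly_continuous_on ?D r"
    unfolding uniformly_continuous_on_def dist_norm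
    using le by (auto simp: r) (meson order_le_less_trans)
  then obtain \<rho> where \<rho>: "uniformly_continuous_on (closure ?D) \<rho>" "\<And>x. x \<in> ?D \<Longrightarrow> r x = \<rho> x"
    by (rule uniformly_continuous_on_extension_on_closure) blast
  then have cont: "continuous_on UNIV \<rho>"
    using uniformly_continuous_imp_continuous dense by metis
  have \<rho>_int: "\<rho> (integrated_form \<iota> V f) = integrated_form \<pi> W f" if "finitely_supported f" for f
    using \<rho>(2)[of "integrated_form \<iota> V f"] r[OF that] that by auto
  have ext: "F z = H z"
    if "continuous_on UNIV F" "continuous_on UNIV H" "\<And>w. w \<in> T \<Longrightarrow> F w = H w" "closure T = UNIV"
    for F H :: "'c::topological_space \<Rightarrow> 'd" and T z
  proof -
    have "closed {w. F w = H w}" using that by (intro closed_Collect_eq)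
    then have "closure T \<subseteq> {w. F w = H w}" using that by (intro closure_minimal) auto
    with that show ?thesis by auto
  qed
  have cont': "continuous_on A (\<lambda>z. \<rho> (k z))" if "continuous_on A k" for A k
    using continuous_on_compose2[OF cont that] by simp
  have dense2: "closure (?D \<times> ?D) = UNIV" by (simp add: closure_Times dense)
  have "\<rho> (x + y) = \<rho> x + \<rho> y" for x y
    using ext[of "\<lambda>z. \<rho> (fst z + snd z)" "\<lambda>z. \<rho> (fst z) + \<rho> (snd z)" "?D \<times> ?D" "(x, y)"] dense2
    by (force intro!: continuous_intros cont' simp: integrated_form_add[symmetric] \<iota> \<pi> \<rho>_int
        finitely_supported_add)
  moreover have "\<rho> (x * y) = \<rho> x * \<rho> y" for x y
    using ext[of "\<lambda>z. \<rho> (fst z * snd z)" "\<lambda>z. \<rho> (fst z) * \<rho> (snd z)" "?D \<times> ?D" "(x, y)"] dense2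
    by (force intro!: continuous_intros cont' simp: integrated_form_twisted_mult[OF \<alpha> _ _ cov, symmetric]
        integrated_form_twisted_mult[OF \<alpha> _ _ cov', symmetric] \<rho>_int finitely_supported_twisted_mult[OF \<alpha>])
  moreover have "\<rho> (c *\<^sub>C x) = c *\<^sub>C \<rho> x" for c x
    using ext[of "\<lambda>z. \<rho> (c *\<^sub>C z)" "\<lambda>z. c *\<^sub>C \<rho> z" ?D x] dense
    by (force intro!: continuous_intros cont' simp: integrated_form_scaleC[symmetric] \<iota> \<pi> \<rho>_int
        finitely_supported_scaleC)
  moreover have "\<rho> (star x) = star (\<rho> x)" for x
    using ext[of "\<lambda>z. \<rho> (star z)" "\<lambda>z. star (\<rho> z)" ?D x] dense
    by (force intro!: continuous_intros cont' simp: integrated_form_twisted_star[OF \<alpha> _ cov, symmetric]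
        integrated_form_twisted_star[OF \<alpha> _ cov', symmetric] \<rho>_int finitely_supported_twisted_star[OF \<alpha>])
  moreover have gens: "\<rho> (\<iota> a * unitary_power V k) = \<pi> a * unitary_power W k" for a k
    using \<rho>_int[OF integrated_form_single(2)[OF \<iota>], of k a]
    by (simp add: integrated_form_single(1)[OF \<iota>] integrated_form_single(1)[OF \<pi>])
  have \<rho>_\<iota>: "\<rho> (\<iota> a) = \<pi> a" for a using gens[of a 0] by simp
  have \<rho>_V: "\<rho> V = W" using gens[of 1 1] by (simp add: unital_star_homD[OF \<iota>] unital_star_homD[OF \<pi>])
  have "\<rho> 1 = 1" using \<rho>_\<iota>[of 1] by (simp add: unital_star_homD[OF \<iota>] unital_star_homD[OF \<pi>])
  ultimately have hom: "unital_star_hom \<rho>" by (simp add: unital_star_hom_def)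
  show ?thesis
  proof (rule ex1I[of _ \<rho>])
    show "unital_star_hom \<rho> \<and> continuous_on UNIV \<rho> \<and> (\<forall>a. \<rho> (\<iota> a) = \<pi> a) \<and> \<rho> V = W"
      using hom cont \<rho>_\<iota> \<rho>_V by simp
  next
    fix \<sigma> assume \<sigma>: "unital_star_hom \<sigma> \<and> continuous_on UNIV \<sigma> \<and> (\<forall>a. \<sigma> (\<iota> a) = \<pi> a) \<and> \<sigma> V = W"
    then have h: "unital_star_hom \<sigma>" by simp
    have pow: "\<sigma> (x ^ k) = \<sigma> x ^ k" for x k
      by (induction k) (simp_all add: unital_star_homD[OF h])
    have "\<sigma> (unitary_power V k) = unitary_power W k" for k
      using \<sigma> by (simp add: unitary_power_def pow unital_star_homD[OF h])
    then have \<sigma>_int: "\<sigma> (integrated_form \<iota> V f) = integrated_form \<pi> W f" for f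
      using \<sigma> by (simp add: integrated_form_def unital_star_homD[OF h])
    have D: "\<sigma> w = \<rho> w" if "w \<in> ?D" for w
      using that by (auto simp only: \<sigma>_int \<rho>_int mem_Collect_eq)
    show "\<sigma> = \<rho>"
    proof (rule HOL.ext)
      fix z
      show "\<sigma> z = \<rho> z"
        by (rule ext[OF _ cont D dense]) (use \<sigma> in auto)
    qed
  qed
qed

text \<open>
  \<open>skew_product \<theta> u \<iota> V \<Phi>\<close>: each \<open>\<Phi> g\<close> is the automorphism of the crossed product with
  $\Phi_g(a)=\theta_g(a)$ and $\Phi_g(V)=u_gV$. These conditions determine \<open>\<Phi>\<close>.
\<close>

definition skew_product ::
    "('g \<Rightarrow> 'a \<Rightarrow> 'a) \<Rightarrow> ('g \<Rightarrow> 'a) \<Rightarrow> ('a::unital_cstar_algebra \<Rightarrow> 'b::unital_cstar_algebra) \<Rightarrow> 'b \<Rightarrow>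
      ('g \<Rightarrow> 'b \<Rightarrow> 'b) \<Rightarrow> bool"
  where "skew_product \<theta> u \<iota> V \<Phi> \<longleftrightarrow>
    (\<forall>g. star_automorphism (\<Phi> g) \<and> (\<forall>a. \<Phi> g (\<iota> a) = \<iota> (\<theta> g a)) \<and> \<Phi> g V = \<iota> (u g) * V)"

section \<open>The circle\<close>

typedef circle = "sphere (0 :: complex) 1"
  by (auto intro: exI[of _ 1])

instantiation circle :: metric_space
begin

definition dist_circle :: "circle \<Rightarrow> circle \<Rightarrow> real"
  where "dist_circle z w = dist (Rep_circle z) (Rep_circle w)"

definition uniformity_circle :: "(circle \<times> circle) filter"
  where "uniformity_circle = (INF e\<in>{0<..}. principal {(x, y). dist x y < e})"

definition open_circle :: "circle set \<Rightarrow> bool"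
  where "open_circle S = (\<forall>x\<in>S. \<forall>\<^sub>F (x', y) in uniformity. x' = x \<longrightarrow> y \<in> S)"

instance
  by standard
    (simp_all add: dist_circle_def Rep_circle_inject uniformity_circle_def open_circle_def
      dist_triangle2)

end

end

theory Submission
  imports Defs
begin

text \<open>
  The gauge action $V \mapsto zV$ commutes with the skew product, so the Fourier components
  $a_n V^n$ of a fixed point are fixed. If $aV^n$ and $bV^n$ are fixed, then $ab^*$ is a
  $\theta$-fixed function and hence scalar by unique ergodicity and amenability. So the homogeneous
  fixed points of degree $n$ form a space of dimension at most one, spanned by a unitary if it is
  not zero, and the degrees that occur form a subgroup $k\mathbb Z$. Fejer summation shows that
  $k = 0$ would mean weak ergodicity, and that otherwise the fixed-point algebra is generated
  by a unitary $W$ of degree $k$. The Fourier components also bound the coefficients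
  of a Laurent polynomial in $W$ by its norm, which forces the norm of such a polynomial to be the
  supremum norm on $\mathbb T$.
\<close>

section \<open>Homomorphisms of $C^*$-algebras\<close>

text \<open>Three analytic facts are supplied without spectral theory. Homomorphisms are
  contractive, so gauge averages can be formed and estimated. The copy of C(X) in the crossed
  product is closed, so a limit of coefficients is again a coefficient; this comes from injectivity,
  because an injective homomorphism on a function algebra is isometric. Finally, functional calculus
  for W: C(T) is shown to be the universal crossed product of the scalars by the trivial
  automorphism, and its universal property yields a homomorphism sending the coordinate to W. One
  estimate serves twice here: every C*-seminorm on Laurent polynomials is dominated by a C*-norm
  that controls coefficients. With the sup norm as the dominating one this gives universality of
  C(T); with the sup norm as the dominated one it gives that the homomorphism is isometric.\<close>

lemma bounded_linear_star: "bounded_linear (star :: 'a::unital_cstar_algebra \<Rightarrow> 'a)"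
  by (rule bounded_linear_intro[where K = 1])
    (simp_all add: star_add scaleC_of_real[symmetric] star_scaleC)

lemma bounded_linear_scaleC_right:
  "bounded_linear (\<lambda>x. c *\<^sub>C x :: 'a::unital_cstar_algebra)"
  by (rule bounded_linear_intro[where K = "cmod c"])
    (simp_all add: scaleC_add_right scaleC_of_real[symmetric] scaleC_scaleC norm_scaleC mult.commute)

lemma bounded_linear_scaleC_left:
  "bounded_linear (\<lambda>c. c *\<^sub>C (x :: 'a::unital_cstar_algebra))"
  by (rule bounded_linear_intro[where K = "norm x"])
    (simp_all add: scaleC_add_left scaleC_of_real[symmetric] scaleC_scaleC norm_scaleC scaleR_conv_of_real
      scaleC_complex_def)

lemma scaleC_one [simp]: "1 *\<^sub>C x = (x :: 'a::unital_cstar_algebra)"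
  using scaleC_of_real[of 1 x] by simp

lemma scaleC_zero_left [simp]: "0 *\<^sub>C x = (0 :: 'a::unital_cstar_algebra)"
  using scaleC_of_real[of 0 x] by simp

text \<open>Successive binomial coefficients have ratio (1/2 - n)/(n + 1), of absolute value at most
  1. This controls the power series of the square root.\<close>

lemma abs_gbinomial_half_le: "\<bar>(1/2 :: real) gchoose n\<bar> \<le> 1"
proof (induction n)
  case (Suc n)
  have "(1/2 :: real) * (1/2 gchoose n) = of_nat n * (1/2 gchoose n) + of_nat (Suc n) * (1/2 gchoose Suc n)"
    by (rule gbinomial_mult_1)
  then have "(1/2 :: real) gchoose Suc n = ((1/2 - real n) / (1 + real n)) * (1/2 gchoose n)"
    by (simp add: field_simps)
  moreover have "\<bar>(1/2 - real n) / (1 + real n)\<bar> \<le> 1"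
    by (simp add: abs_if divide_simps)
  ultimately show ?case
    using Suc by (simp only: abs_mult mult_le_one abs_ge_zero)
qed simp

text \<open>The binomial series of (1 - y)^(1/2) converges absolutely, and Vandermonde's identity
  for 1/2 + 1/2 = 1 collapses its square to 1 - y. The commutation clause is there because the root
  of 1 - h^2 has to commute with h when the two are combined into a unitary.\<close>

lemma sqrt_one_minus_exists:
  fixes y :: "'a::unital_cstar_algebra"
  assumes "norm y < 1" "star y = y"
  shows "\<exists>s. s * s = 1 - y \<and> star s = s \<and> (\<forall>h. h * y = y * h \<longrightarrow> h * s = s * h)"
proof -
  define a where "a n = ((1/2 :: real) gchoose n) *\<^sub>R (- y) ^ n" for n
  define s where "s = suminf a"
  have "norm (a n) \<le> norm y ^ n" for n
  proof -
    have "norm (a n) \<le> 1 * norm ((- y) ^ n)"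
      unfolding a_def norm_scaleR real_norm_def
      by (intro mult_right_mono abs_gbinomial_half_le) simp
    also have "\<dots> \<le> norm y ^ n" using norm_power_ineq[of "- y" n] by simp
    finally show ?thesis .
  qed
  then have sn: "summable (\<lambda>n. norm (a n))"
    using assms(1) by (intro summable_comparison_test[OF _ summable_geometric[of "norm y"]]) auto
  then have sa: "summable a" by (rule summable_norm_cancel)
  have "s * s = (\<Sum>k. \<Sum>i\<le>k. a i * a (k - i))"
    unfolding s_def by (rule Cauchy_product[OF sn sn])
  also have "\<dots> = (\<Sum>k. ((1 :: real) gchoose k) *\<^sub>R (- y) ^ k)"
  proof (rule suminf_cong)
    fix k
    have "(\<Sum>i\<le>k. a i * a (k - i)) =
        (\<Sum>i\<le>k. ((1/2 :: real) gchoose i) * (1/2 gchoose (k - i))) *\<^sub>R (- y) ^ k"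
      unfolding scaleR_sum_left
      by (rule sum.cong) (simp_all add: a_def power_add[symmetric])
    then show "(\<Sum>i\<le>k. a i * a (k - i)) = ((1 :: real) gchoose k) *\<^sub>R (- y) ^ k"
      using gbinomial_Vandermonde[of "1/2 :: real" "1/2" k] by (simp add: atLeast0AtMost)
  qed
  also have "\<dots> = (\<Sum>k\<in>{0, 1}. ((1 :: real) gchoose k) *\<^sub>R (- y) ^ k)"
  proof (rule suminf_finite)
    fix k :: nat assume "k \<notin> {0, 1}"
    then have "1 choose k = 0" by (simp add: binomial_eq_0)
    then have "(1 :: real) gchoose k = 0" by (metis binomial_gbinomial of_nat_0 of_nat_1)
    then show "((1 :: real) gchoose k) *\<^sub>R (- y) ^ k = 0" by simp
  qed simp
  also have "\<dots> = 1 - y" by simp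
  finally have sq: "s * s = 1 - y" .
  have sp: "star (x ^ k) = star x ^ k" for x :: 'a and k
    by (induction k) (simp_all add: star_mult power_commutes)
  have "star s = (\<Sum>n. star (a n))"
    unfolding s_def by (rule bounded_linear.suminf[OF bounded_linear_star sa])
  also have "star (a n) = a n" for n
    using assms(2) by (simp add: a_def star_scaleC sp star_minus flip: scaleC_of_real)
  then have "(\<Sum>n. star (a n)) = s" by (simp add: s_def)
  finally have st: "star s = s" .
  have "h * s = s * h" if h: "h * y = y * h" for h
  proof -
    have hp: "h * (- y) ^ n = (- y) ^ n * h" for n
      by (rule power_commuting_commutes[symmetric]) (simp add: h)
    have "h * s = (\<Sum>n. h * a n)" unfolding s_def by (rule suminf_mult[OF sa, symmetric])
    also have "\<dots> = (\<Sum>n. a n * h)" by (simp add: a_def hp)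
    also have "\<dots> = s * h" unfolding s_def by (rule suminf_mult2[OF sa, symmetric])
    finally show ?thesis .
  qed
  with sq st show ?thesis by blast
qed

lemma norm_unitary: "unitary w \<Longrightarrow> norm w = 1"
  using norm_star_mult_self[of w] by (simp add: unitary_def power2_eq_1_iff) (smt (verit) norm_ge_zero)

lemma unital_star_hom_norm_le:
  fixes \<pi> :: "'a::unital_cstar_algebra \<Rightarrow> 'b::unital_cstar_algebra"
  assumes \<pi>: "unital_star_hom \<pi>"
  shows "norm (\<pi> x) \<le> norm x"
proof -
  note hom = unital_star_homD[OF \<pi>]
  \<comment> \<open>A self-adjoint contraction is the real part of the unitary $h + i\sqrt{1-h^2}$, and
    unitaries are mapped to unitaries.\<close>
  have contr: "norm (\<pi> h) \<le> 1" if h: "star h = h" "norm h < 1" for h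
  proof -
    have "norm (h * h) = (norm h)\<^sup>2" using norm_star_mult_self[of h] h(1) by simp
    also have "\<dots> < 1" using h(2) by (simp add: power2_eq_square) (smt (verit) mult_le_one norm_ge_zero mult_left_le)
    finally obtain s where s: "s * s = 1 - h * h" "star s = s" "h * s = s * h"
      using sqrt_one_minus_exists[of "h * h"] h(1) by (auto simp: star_mult mult.assoc)
    define w where "w = h + \<i> *\<^sub>C s"
    have sw: "star w = h + (- \<i>) *\<^sub>C s" by (simp add: w_def star_add star_scaleC s h)
    have c: "\<i> *\<^sub>C z + (- \<i>) *\<^sub>C z = 0" for z :: 'a
      by (simp flip: scaleC_add_left)
    have "star w * w = h * h + s * s + (\<i> *\<^sub>C (h * s) + (- \<i>) *\<^sub>C (h * s))"
      "w * star w = h * h + s * s + (\<i> *\<^sub>C (h * s) + (- \<i>) *\<^sub>C (h * s))"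
      unfolding sw unfolding w_def
      by (simp_all add: algebra_simps mult_scaleC_left mult_scaleC_right scaleC_scaleC scaleC_add_right s(3))
    then have w: "star w * w = 1" "w * star w = 1" by (simp_all add: c s)
    then have "unitary (\<pi> w)" by (simp add: unitary_def hom(5) flip: hom(3,4))
    then have nw: "norm (\<pi> w) = 1" by (rule norm_unitary)
    have "w + star w = 2 *\<^sub>C h"
    proof -
      have "w + star w = h + h + (\<i> *\<^sub>C s + (- \<i>) *\<^sub>C s)" by (simp add: w_def sw[unfolded w_def])
      also have "\<dots> = 2 *\<^sub>C h"
        using scaleC_add_left[of 1 1 h] by (simp add: c)
      finally show ?thesis .
    qed
    then have "2 *\<^sub>C \<pi> h = \<pi> w + star (\<pi> w)" by (metis hom(1,2,4))
    then have "2 * norm (\<pi> h) = norm (\<pi> w + star (\<pi> w))"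
      using norm_scaleC[of 2 "\<pi> h"] by simp
    also have "\<dots> \<le> norm (\<pi> w) + norm (star (\<pi> w))" by (rule norm_triangle_ineq)
    finally show ?thesis using nw by simp
  qed
  \<comment> \<open>The root behind \<open>contr\<close> needs a strict bound, so h is rescaled by
    some r strictly between its norm and the supposedly larger norm of its image.\<close>
  have sa: "norm (\<pi> h) \<le> norm h" if h: "star h = h" for h
  proof (rule ccontr)
    assume "\<not> norm (\<pi> h) \<le> norm h"
    then obtain r where r: "norm h < r" "r < norm (\<pi> h)" using dense by (metis not_le)
    then have "r > 0" using norm_ge_zero[of h] by linarith
    let ?k = "complex_of_real (1 / r) *\<^sub>C h"
    have "star ?k = ?k" by (simp add: star_scaleC h)
    moreover have "norm ?k < 1" using r \<open>r > 0\<close> by (simp add: norm_scaleC norm_divide)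
    ultimately have "norm (\<pi> ?k) \<le> 1" by (rule contr)
    then have "norm (\<pi> h) \<le> r" using \<open>r > 0\<close> by (simp add: hom(2) norm_scaleC norm_divide)
    with r show False by simp
  qed
  \<comment> \<open>The C*-identity reduces a general x to the self-adjoint
    \<open>star x * x\<close>.\<close>
  have "(norm (\<pi> x))\<^sup>2 = norm (\<pi> (star x * x))"
    by (simp add: hom(3,4) norm_star_mult_self)
  also have "\<dots> \<le> norm (star x * x)" by (rule sa) (simp add: star_mult star_star)
  also have "\<dots> = (norm x)\<^sup>2" by (rule norm_star_mult_self)
  finally show ?thesis by (rule power2_le_imp_le) simp
qed

lemma bounded_linear_star_hom:
  assumes "unital_star_hom \<pi>"
  shows "bounded_linear \<pi>"
  by (rule bounded_linear_intro[where K = 1])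
    (simp_all add: unital_star_homD[OF assms] unital_star_hom_norm_le[OF assms]
      flip: scaleC_of_real)

section \<open>Isometry of injective homomorphisms on function algebras\<close>

lemma cnj_mult_self: "cnj z * z = complex_of_real ((cmod z)\<^sup>2)"
  by (metis complex_norm_square mult.commute)

lemma bounded_linear_apply_bcontfun:
  "bounded_linear (\<lambda>f. apply_bcontfun (f :: 'x::topological_space \<Rightarrow>\<^sub>C 'y::real_normed_vector) x)"
  by (rule bounded_linear_intro[where K = 1]) (simp_all add: norm_bounded)

text \<open>A loss of norm at a would put a nonzero function into the kernel: where |a|^2 exceeds r,
  multiplication by |a|^2 is bounded below by r, while its image has norm less than r.\<close>

lemma inj_star_hom_bcontfun_isometric:
  fixes \<pi> :: "('x::metric_space \<Rightarrow>\<^sub>C complex) \<Rightarrow> 'b::unital_cstar_algebra"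
  assumes \<pi>: "unital_star_hom \<pi>" and inj: "inj \<pi>"
  shows "norm (\<pi> a) = norm a"
proof (rule antisym[OF unital_star_hom_norm_le[OF \<pi>]], rule ccontr)
  note hom = unital_star_homD[OF \<pi>]
  assume "\<not> norm a \<le> norm (\<pi> a)"
  define b where "b = star a * a"
  define s where "s x = (cmod (apply_bcontfun a x))\<^sup>2" for x
  have bs: "apply_bcontfun b x = of_real (s x)" for x
    unfolding b_def s_def
    by (simp add: star_complex_def cnj_mult_self)
  have nb: "norm (\<pi> b) < norm b"
    using \<open>\<not> norm a \<le> norm (\<pi> a)\<close>
    by (simp add: b_def hom norm_star_mult_self power_strict_mono)
  then obtain r where r: "norm (\<pi> b) < r" "r < norm b" using dense by blast
  then have "r > 0" using norm_ge_zero[of "\<pi> b"] by linarith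
  have s_cont: "continuous_on UNIV s" unfolding s_def by (auto intro!: continuous_intros)
  have sb: "0 \<le> s x" "s x \<le> norm b" for x
    using norm_bounded[of b x] by (simp_all add: bs s_def norm_power)
  \<comment> \<open>\<open>f\<close> is a nonzero function on which multiplication by \<open>b\<close> is bounded below by \<open>r\<close>,
    with partial inverse \<open>d\<close>.\<close>
  define f :: "'x \<Rightarrow>\<^sub>C complex" where "f = Bcontfun (\<lambda>x. of_real (max 0 (s x - r)))"
  define d :: "'x \<Rightarrow>\<^sub>C complex" where "d = Bcontfun (\<lambda>x. of_real (1 / max (s x) r))"
  have "continuous_on UNIV (\<lambda>x. max 0 (s x - r))" "continuous_on UNIV (\<lambda>x. 1 / max (s x) r)"
    using \<open>r > 0\<close> by (auto intro!: continuous_intros s_cont)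
  note c = this[THEN continuous_on_of_real, where 'a = complex]
  have "cmod (of_real (max 0 (s x - r))) \<le> norm b" for x
    using sb[of x] \<open>r > 0\<close> by simp
  then have f: "apply_bcontfun f x = of_real (max 0 (s x - r))" for x
    unfolding f_def by (subst Bcontfun_inverse[OF bcontfun_normI[OF c(1)]]) blast+
  have mr: "cmod (of_real (1 / max (s x) r)) \<le> 1 / r" for x
    unfolding norm_of_real using \<open>r > 0\<close> by (simp add: max_def divide_simps)
  then have d: "apply_bcontfun d x = of_real (1 / max (s x) r)" for x
    unfolding d_def by (subst Bcontfun_inverse[OF bcontfun_normI[OF c(2)]]) auto
  have dn: "norm d \<le> 1 / r"
    by (rule norm_bound) (simp only: d mr)
  have "b * d * f = f"
    by (rule bcontfun_eqI) (use \<open>r > 0\<close> in \<open>auto simp: bs d f max_def\<close>)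
  \<comment> \<open>Since f = b d f, the norm of \<open>\<pi> f\<close> is at most
    \<open>norm (\<pi> b) / r\<close> times itself, and that factor is below 1; hence
    \<open>\<pi> f = 0\<close>.\<close>
  then have "norm (\<pi> f) \<le> norm (\<pi> b * \<pi> d) * norm (\<pi> f)"
    using norm_mult_ineq[of "\<pi> b * \<pi> d" "\<pi> f"] by (simp flip: hom(3))
  also have "\<dots> \<le> (norm (\<pi> b) * (1 / r)) * norm (\<pi> f)"
    using order_trans[OF unital_star_hom_norm_le[OF \<pi>] dn]
    by (intro mult_right_mono order_trans[OF norm_mult_ineq] mult_left_mono) auto
  finally have "norm (\<pi> f) * (1 - norm (\<pi> b) / r) \<le> 0" by (simp add: algebra_simps)
  moreover have "1 - norm (\<pi> b) / r > 0" using r \<open>r > 0\<close> by simp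
  ultimately have "norm (\<pi> f) \<le> 0" by (simp add: mult_le_0_iff)
  then have "f = 0" using inj hom(6) by (simp add: inj_eq) (metis inj injD)
  then have "s x \<le> r" for x
    using f[of x] by (simp add: max_def split: if_splits)
  then have "norm b \<le> r"
    by (intro norm_bound) (simp add: bs sb)
  with r show False by simp
qed

section \<open>Unique ergodicity\<close>

text \<open>Averaging evaluation at x along orbits with the invariant mean gives an invariant state
  \<open>\<phi> x\<close>. Unique ergodicity makes it independent of x, yet on a fixed function it
  returns the value at x.\<close>

lemma uniquely_ergodic_fixed_point_scalar:
  fixes \<theta> :: "'g::topological_group_add \<Rightarrow> ('x::metric_space \<Rightarrow>\<^sub>C complex) \<Rightarrow> ('x \<Rightarrow>\<^sub>C complex)"
  assumes am: "amenable_group TYPE('g)" and dyn: "cstar_dynamical_system \<theta>"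
    and erg: "uniquely_ergodic \<theta>" and f: "f \<in> fixed_points \<theta>"
  shows "\<exists>c. f = c *\<^sub>C 1"
proof -
  obtain \<mu> :: "'g measure" and m where m: "left_invariant_mean \<mu> m"
    using am by (auto simp: amenable_group_def)
  let ?L = "essentially_bounded \<mu>"
  have madd: "m (\<lambda>x. h x + k x) = m h + m k" if "h \<in> ?L" "k \<in> ?L" for h k
    using m that by (simp add: left_invariant_mean_def)
  have mscale: "m (\<lambda>x. c * h x) = c * m h" if "h \<in> ?L" for h c
    using m that by (simp add: left_invariant_mean_def)
  have mpos: "0 \<le> m h" if "h \<in> ?L" "\<And>x. 0 \<le> h x" for h
    using m that by (simp add: left_invariant_mean_def)
  have m1: "m (\<lambda>x. 1) = 1" and minv: "m (\<lambda>x. h (g + x)) = m h" if "h \<in> ?L" for h g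
    using m that by (simp_all add: left_invariant_mean_def)
  have L1: "(\<lambda>x. 1) \<in> ?L" by (auto simp: essentially_bounded_def)
  have mconst: "m (\<lambda>x. c) = c" for c using mscale[OF L1, of c] m1[OF L1] by simp
  have \<theta>: "unital_star_hom (\<theta> g)" for g
    using dyn by (simp add: cstar_dynamical_system_def star_automorphism_def)
  note hom = unital_star_homD[OF \<theta>]
  have comp: "\<theta> (g + h) b = \<theta> g (\<theta> h b)" for g h b
    using dyn by (simp add: cstar_dynamical_system_def)
  have cont: "continuous_on UNIV (\<lambda>g. \<theta> g b)" for b
    using dyn by (simp add: cstar_dynamical_system_def)
  \<comment> \<open>The orbit is read along $g^{-1}$ because the mean is left invariant.\<close>
  define v where "v x b g = apply_bcontfun (\<theta> (- g) b) x" for x b g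
  have vc: "continuous_on UNIV (v x b)" for x b
  proof -
    have "continuous_on UNIV (\<lambda>g. \<theta> (- g) b)"
      using continuous_on_compose2[OF cont[of b], of UNIV uminus] by (simp add: continuous_on_minus)
    then show ?thesis
      unfolding v_def
      by (rule bounded_linear.continuous_on[OF bounded_linear_apply_bcontfun])
  qed
  have vb: "cmod (v x b g) \<le> norm b" for x b g
    unfolding v_def by (rule order_trans[OF norm_bounded unital_star_hom_norm_le[OF \<theta>]])
  have vL: "(\<lambda>g. Re (v x b g)) \<in> ?L" "(\<lambda>g. Im (v x b g)) \<in> ?L" for x b
    unfolding essentially_bounded_def
    by (auto intro!: borel_measurable_continuous_onI continuous_intros vc exI[of _ "norm b"] AE_I2
        order_trans[OF abs_Re_le_cmod vb] order_trans[OF abs_Im_le_cmod vb])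
  \<comment> \<open>The mean acts on real functions, so it is extended componentwise; homogeneity
    under complex scalars must then be checked on real and imaginary parts.\<close>
  define \<phi> where "\<phi> x b = Complex (m (\<lambda>g. Re (v x b g))) (m (\<lambda>g. Im (v x b g)))" for x b
  have scaleL: "(\<lambda>g. c * h g) \<in> ?L" if "h \<in> ?L" for c h
  proof -
    from that obtain C where "h \<in> borel_measurable borel" "AE x in \<mu>. \<bar>h x\<bar> \<le> C"
      by (auto simp: essentially_bounded_def)
    moreover from this(2) have "AE x in \<mu>. \<bar>c * h x\<bar> \<le> \<bar>c\<bar> * C"
      by eventually_elim (simp add: abs_mult mult_left_mono)
    ultimately show ?thesis by (auto simp: essentially_bounded_def)
  qed
  have "state (\<phi> x)" for x
    unfolding state_def
  proof (intro conjI allI)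
    fix a b :: "'x \<Rightarrow>\<^sub>C complex" and c
    show "\<phi> x (a + b) = \<phi> x a + \<phi> x b"
      using madd[OF vL(1)[of x a] vL(1)[of x b]] madd[OF vL(2)[of x a] vL(2)[of x b]]
      by (simp add: \<phi>_def v_def hom complex_eq_iff)
    have "v x (c *\<^sub>C a) g = c * v x a g" for g
      by (simp add: v_def hom scaleC_complex_def)
    then show "\<phi> x (c *\<^sub>C a) = c * \<phi> x a"
      using madd[OF scaleL[OF vL(1)[of x a], of "Re c"] scaleL[OF vL(2)[of x a], of "- Im c"]]
        madd[OF scaleL[OF vL(2)[of x a], of "Re c"] scaleL[OF vL(1)[of x a], of "Im c"]]
        mscale[OF vL(2)[of x a], of "- Im c"]
      by (simp add: \<phi>_def complex_eq_iff mscale[OF vL(1)] mscale[OF vL(2)] mult.commute)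
    have "v x (star a * a) g = of_real ((cmod (v x a g))\<^sup>2)" for g
      unfolding v_def
      by (simp add: hom star_complex_def cnj_mult_self)
    then have re: "Re (v x (star a * a) g) = (cmod (v x a g))\<^sup>2"
      and im: "Im (v x (star a * a) g) = 0" for g by simp_all
    show "\<phi> x (star a * a) \<in> \<real>" by (simp add: \<phi>_def im mconst complex_is_Real_iff)
    show "0 \<le> Re (\<phi> x (star a * a))"
      using mpos[OF vL(1)[of x "star a * a"]] by (simp add: \<phi>_def re)
    show "\<phi> x 1 = 1" by (simp add: \<phi>_def v_def hom mconst complex_eq_iff)
  qed
  moreover have "\<phi> x \<circ> \<theta> h = \<phi> x" for x h
  proof
    fix b
    have "v x (\<theta> h b) g = v x b (- h + g)" for g
      by (simp add: v_def minus_add flip: comp)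
    then show "(\<phi> x \<circ> \<theta> h) b = \<phi> x b"
      using minv[OF vL(1)[of x b], of "- h"] minv[OF vL(2)[of x b], of "- h"]
      by (simp add: \<phi>_def)
  qed
  ultimately have eq: "\<phi> x = \<phi> y" for x y
    using erg unfolding uniquely_ergodic_def by blast
  have "\<phi> x f = apply_bcontfun f x" for x
    using f by (simp add: \<phi>_def v_def fixed_points_def mconst complex_eq_iff)
  then have "apply_bcontfun f x = apply_bcontfun f y" for x y
    using eq by metis
  then have "f = apply_bcontfun f undefined *\<^sub>C 1"
    by (intro bcontfun_eqI) (simp add: scaleC_complex_def)
  then show ?thesis by blast
qed

section \<open>The gauge action on a crossed product by $\mathbb Z$\<close>

text \<open>The orthogonality relation behind the Fourier projections, the mass of the Fejer kernel
  and the coefficient bound on the circle.\<close>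

lemma has_integral_cis_int:
  "((\<lambda>t. cis (of_int k * t)) has_integral (if k = 0 then of_real (2 * pi) else 0)) {0..2 * pi}"
proof (cases "k = 0")
  case False
  have "((\<lambda>t. cis (of_int k * t)) has_integral
      cis (of_int k * (2 * pi)) / (\<i> * of_int k) - cis (of_int k * 0) / (\<i> * of_int k)) {0..2 * pi}"
  proof (rule fundamental_theorem_of_calculus)
    fix t :: real
    have "((\<lambda>z. exp (\<i> * of_int k * z) / (\<i> * of_int k)) has_field_derivative
        exp (\<i> * of_int k * of_real t)) (at (of_real t))"
      using False by (auto intro!: derivative_eq_intros)
    from has_vector_derivative_real_field[OF this]
    show "((\<lambda>t. cis (of_int k * t) / (\<i> * of_int k)) has_vector_derivative cis (of_int k * t))
        (at t within {0..2 * pi})"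
      by (simp add: cis_conv_exp mult.assoc)
  qed simp
  moreover have "cis (of_int k * (2 * pi)) = 1"
    by (metis cis_multiple_2pi Ints_of_int mult.commute)
  ultimately show ?thesis using False by simp
qed (use has_integral_const_real[of "1::complex" 0 "2 * pi"] in \<open>simp add: scaleR_conv_of_real\<close>)

locale crossed_product =
  fixes \<alpha> :: "'a::unital_cstar_algebra \<Rightarrow> 'a"
    and \<iota> :: "'a \<Rightarrow> 'b::unital_cstar_algebra"
    and V :: 'b
  assumes automorphism: "star_automorphism \<alpha>"
    and universal: "universal_crossed_product \<alpha> \<iota> V"
begin

lemma covariant: "covariant_pair \<alpha> \<iota> V"
  using universal by (simp add: universal_crossed_product_def)

lemma iota_hom: "unital_star_hom \<iota>"
  using covariant by (simp add: covariant_pair_def)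

lemma unitary_V: "unitary V"
  using covariant by (simp add: covariant_pair_def)

lemma unitary_power_V_cancel:
  "unitary_power V n * unitary_power V (- n) = 1" "unitary_power V (- n) * unitary_power V n = 1"
  by (simp_all flip: unitary_power_add[OF unitary_V])

lemma basis_mult:
  "(\<iota> a * unitary_power V m) * (\<iota> b * unitary_power V n) =
    \<iota> (a * int_funpow \<alpha> m b) * unitary_power V (m + n)"
  using covariant_pair_power[OF automorphism covariant, of m b]
  by (metis (no_types, lifting) mult.assoc unital_star_homD(3)[OF iota_hom] unitary_power_add[OF unitary_V])

lemma basis_star:
  "star (\<iota> a * unitary_power V n) = \<iota> (int_funpow \<alpha> (- n) (star a)) * unitary_power V (- n)"
  by (simp add: star_mult star_unitary_power covariant_pair_power[OF automorphism covariant]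
      flip: unital_star_homD(4)[OF iota_hom])

text \<open>Scalars can be absorbed into the coefficient a, so closure under sums already captures
  the dense algebra of finite sums. Continuity and convergence statements thereby reduce to
  monomials.\<close>

lemma closed_additive_set_contains:
  assumes "closed S" and basis: "\<And>a n. \<iota> a * unitary_power V n \<in> S"
    and add: "\<And>x y. x \<in> S \<Longrightarrow> y \<in> S \<Longrightarrow> x + y \<in> S"
  shows "x \<in> S"
proof -
  have "0 \<in> S" using basis[of 0 0] by (simp add: unital_star_homD[OF iota_hom])
  then have sum: "sum h A \<in> S" if "\<And>i. h i \<in> S" for h :: "int \<Rightarrow> 'b" and A
    by (induction A rule: infinite_finite_induct) (simp_all add: add that)
  have "integrated_form \<iota> V f \<in> S" for f
    unfolding integrated_form_def by (rule sum) (rule basis)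
  then have "closure (integrated_form \<iota> V ` {f. finitely_supported f}) \<subseteq> S"
    using \<open>closed S\<close> by (intro closure_minimal) auto
  then show ?thesis using universal_crossed_product_dense[OF automorphism universal] by auto
qed

text \<open>Homomorphisms are automatically continuous, so uniqueness in the universal property
  applies to the covariant pair that both induce.\<close>

lemma hom_eqI:
  fixes \<rho> \<sigma> :: "'b \<Rightarrow> 'd::unital_cstar_algebra"
  assumes \<rho>: "unital_star_hom \<rho>" and \<sigma>: "unital_star_hom \<sigma>"
    and "\<And>a. \<rho> (\<iota> a) = \<sigma> (\<iota> a)" and "\<rho> V = \<sigma> V"
  shows "\<rho> = \<sigma>"
proof -
  note h = unital_star_homD[OF \<rho>]
  have "covariant_pair \<alpha> (\<lambda>a. \<rho> (\<iota> a)) (\<rho> V)"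
    using covariant unfolding covariant_pair_def unital_star_hom_def unitary_def
    by (simp add: h flip: h(3,4))
  from universal_crossed_product_hom[OF automorphism universal this]
  show ?thesis
    using assms bounded_linear_star_hom[OF \<rho>] bounded_linear_star_hom[OF \<sigma>]
    by (metis linear_continuous_on)
qed

text \<open>The multiple \<open>cis t *\<^sub>C V\<close> implements \<alpha> as well, because the
  phase cancels in conjugation.\<close>

lemma gauge_exists:
  "\<exists>\<rho>. unital_star_hom \<rho> \<and> (\<forall>a. \<rho> (\<iota> a) = \<iota> a) \<and> \<rho> V = cis t *\<^sub>C V"
proof -
  have "covariant_pair \<alpha> \<iota> (cis t *\<^sub>C V)"
    using covariant unfolding covariant_pair_def unitary_def
    by (simp add: star_scaleC mult_scaleC_left mult_scaleC_right scaleC_scaleC cis_cnj cis_mult)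
  from universal_crossed_product_hom[OF automorphism universal this] show ?thesis by blast
qed

text \<open>Parametrised by an angle instead of a point of the circle, so that averages are ordinary
  integrals over [0, 2 pi].\<close>

definition gauge :: "real \<Rightarrow> 'b \<Rightarrow> 'b"
  where "gauge t = (SOME \<rho>. unital_star_hom \<rho> \<and> (\<forall>a. \<rho> (\<iota> a) = \<iota> a) \<and> \<rho> V = cis t *\<^sub>C V)"

lemma gauge_hom: "unital_star_hom (gauge t)"
  and gauge_iota: "gauge t (\<iota> a) = \<iota> a"
  and gauge_V: "gauge t V = cis t *\<^sub>C V"
  using someI_ex[OF gauge_exists[of t]] by (simp_all add: gauge_def)

lemma gauge_basis:
  "gauge t (\<iota> a * unitary_power V n) = cis (of_int n * t) *\<^sub>C (\<iota> a * unitary_power V n)"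
proof -
  note h = unital_star_homD[OF gauge_hom]
  have pow: "gauge t (x ^ k) = cis (real k * s) *\<^sub>C x ^ k" if "gauge t x = cis s *\<^sub>C x" for x k s
    by (induction k) (simp_all add: h that mult_scaleC_left mult_scaleC_right scaleC_scaleC cis_mult
        distrib_right add.commute)
  have "gauge t (star V) = cis (- t) *\<^sub>C star V"
    by (simp add: h gauge_V star_scaleC cis_cnj)
  then have "gauge t (unitary_power V n) = cis (of_int n * t) *\<^sub>C unitary_power V n"
    using pow[of V t "nat n"] pow[of "star V" "- t" "nat (- n)"] gauge_V
    by (simp add: unitary_power_def)
  then show ?thesis by (simp add: h gauge_iota mult_scaleC_right)
qed

lemma continuous_gauge: "continuous_on UNIV (\<lambda>t. gauge t x)"
proof -
  let ?S = "{x. continuous_on UNIV (\<lambda>t. gauge t x)}"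
  have "x \<in> ?S"
  proof (rule closed_additive_set_contains)
    show "closed ?S"
      unfolding closed_sequential_limits
    proof (intro allI impI, elim conjE)
      fix X l assume X: "\<forall>n. X n \<in> ?S" and l: "X \<longlonglongrightarrow> l"
      \<comment> \<open>All gauge maps are contractions, so \<open>X n\<close> converges to its
        limit uniformly in t after applying them, and continuity survives.\<close>
      have "uniform_limit UNIV (\<lambda>n t. gauge t (X n)) (\<lambda>t. gauge t l) sequentially"
      proof (rule uniform_limitI)
        fix e :: real assume "e > 0"
        with l have "\<forall>\<^sub>F n in sequentially. dist (X n) l < e" by (rule tendstoD)
        then show "\<forall>\<^sub>F n in sequentially. \<forall>t\<in>UNIV. dist (gauge t (X n)) (gauge t l) < e"
        proof eventually_elim
          case (elim n)
          have "dist (gauge t (X n)) (gauge t l) \<le> dist (X n) l" for t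
            using unital_star_hom_norm_le[OF gauge_hom[of t], of "X n - l"]
            by (simp add: dist_norm linear_diff bounded_linear.linear bounded_linear_star_hom gauge_hom)
          with elim show ?case by (meson le_less_trans)
        qed
      qed
      then show "l \<in> ?S"
        using uniform_limit_theorem[of UNIV "\<lambda>n t. gauge t (X n)" sequentially] X by simp
    qed
  next
    fix a n
    show "\<iota> a * unitary_power V n \<in> ?S"
      by (auto simp: gauge_basis intro!: bounded_linear.continuous_on[OF bounded_linear_scaleC_left]
          continuous_intros)
  next
    fix x y assume "x \<in> ?S" "y \<in> ?S"
    then show "x + y \<in> ?S"
      by (auto simp: unital_star_homD[OF gauge_hom] intro!: continuous_intros)
  qed
  then show ?thesis by simp
qed

lemma gauge_integrable:
  assumes "continuous_on UNIV k"
  shows "(\<lambda>t. k t *\<^sub>C gauge t x) integrable_on {0..2 * pi}"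
proof -
  have "bounded_bilinear (\<lambda>c (x::'b). c *\<^sub>C x)"
    by (rule bounded_bilinear.intro)
      (auto simp: scaleC_add_left scaleC_add_right norm_scaleC scaleC_scaleC mult.commute
        scaleC_complex_def intro: exI[of _ 1] simp flip: scaleC_of_real)
  then have "continuous_on UNIV (\<lambda>t. k t *\<^sub>C gauge t x)"
    using assms continuous_gauge by (rule bounded_bilinear.continuous_on)
  then show ?thesis
    by (intro integrable_continuous_interval) (auto intro: continuous_on_subset)
qed

text \<open>\<open>fourier n x\<close> is the homogeneous part \<open>a * V^n\<close> of \<open>x\<close>, not its coefficient \<open>a\<close>.\<close>

definition fourier :: "int \<Rightarrow> 'b \<Rightarrow> 'b"
  where "fourier n x = (1 / (2 * pi)) *\<^sub>R integral {0..2 * pi} (\<lambda>t. cis (of_int (- n) * t) *\<^sub>C gauge t x)"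

lemma fourier_integrable: "(\<lambda>t. cis (of_int n * t) *\<^sub>C gauge t x) integrable_on {0..2 * pi}"
  by (rule gauge_integrable) (intro continuous_intros)

lemma fourier_basis:
  "fourier n (\<iota> a * unitary_power V m) = (if m = n then \<iota> a * unitary_power V n else 0)"
proof -
  let ?y = "\<iota> a * unitary_power V m"
  have "cis (of_int (- n) * t) *\<^sub>C gauge t ?y = cis (of_int (m - n) * t) *\<^sub>C ?y" for t
    by (simp add: gauge_basis scaleC_scaleC cis_mult algebra_simps)
  moreover have "integral {0..2 * pi} (\<lambda>t. cis (of_int (m - n) * t) *\<^sub>C ?y) =
      integral {0..2 * pi} (\<lambda>t. cis (of_int (m - n) * t)) *\<^sub>C ?y"
    using integral_linear[OF _ bounded_linear_scaleC_left[of ?y],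
        of "\<lambda>t. cis (of_int (m - n) * t)" "{0..2 * pi}"]
    by (simp add: o_def integrable_continuous_interval continuous_intros)
  ultimately show ?thesis
    unfolding fourier_def by (simp only: integral_unique[OF has_integral_cis_int]) (simp add: scaleC_of_real del: of_real_mult)
qed

lemma norm_fourier_le: "norm (fourier n x) \<le> norm x"
proof -
  have "norm (integral {0..2 * pi} (\<lambda>t. cis (of_int (- n) * t) *\<^sub>C gauge t x)) \<le>
      integral {0..2 * pi} (\<lambda>t. norm x)"
    by (rule integral_norm_bound_integral[OF fourier_integrable])
      (auto simp: norm_scaleC unital_star_hom_norm_le[OF gauge_hom])
  then show ?thesis by (simp add: fourier_def field_simps)
qed

lemma bounded_linear_fourier: "bounded_linear (fourier n)"
proof (rule bounded_linear_intro[where K = 1])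
  note h = unital_star_homD[OF gauge_hom]
  show "fourier n (x + y) = fourier n x + fourier n y" for x y
    by (simp only: fourier_def h scaleC_add_right integral_add[OF fourier_integrable fourier_integrable]
        scaleR_add_right)
  show "fourier n (r *\<^sub>R x) = r *\<^sub>R fourier n x" for r x
    using bounded_linear_star_hom[OF gauge_hom]
    by (simp add: fourier_def linear_scale bounded_linear.linear
        bounded_linear.linear[OF bounded_linear_scaleC_right])
qed (use norm_fourier_le in simp)

lemma fourier_scaleC: "fourier n (c *\<^sub>C x) = c *\<^sub>C fourier n x"
proof -
  have "cis (of_int (- n) * t) *\<^sub>C gauge t (c *\<^sub>C x) = c *\<^sub>C (cis (of_int (- n) * t) *\<^sub>C gauge t x)" for t
    by (simp add: unital_star_homD[OF gauge_hom] scaleC_scaleC mult.commute)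
  then show ?thesis
    using integral_linear[OF fourier_integrable[of "- n" x] bounded_linear_scaleC_right[of c]]
    by (simp add: fourier_def o_def linear_scale[OF bounded_linear.linear[OF bounded_linear_scaleC_right]])
qed

text \<open>Multiplication by the power -n of V moves the component into degree 0. For monomials the
  result visibly lies in the range of \<iota>, and closedness of that range carries this to
  limits.\<close>

lemma fourier_in_range:
  assumes "closed (range \<iota>)"
  shows "\<exists>a. fourier n x = \<iota> a * unitary_power V n"
proof -
  let ?S = "{x. fourier n x * unitary_power V (- n) \<in> range \<iota>}"
  have "x \<in> ?S"
  proof (rule closed_additive_set_contains)
    have "?S = (\<lambda>x. fourier n x * unitary_power V (- n)) -` range \<iota>" by auto
    also have "closed \<dots>"
      by (intro continuous_closed_vimage assms continuous_intros
          bounded_linear.isCont[OF bounded_linear_fourier])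
    finally show "closed ?S" .
  next
    fix a m
    show "\<iota> a * unitary_power V m \<in> ?S"
      using rangeI[of \<iota> 0]
      by (auto simp: fourier_basis mult.assoc unitary_power_V_cancel unital_star_homD[OF iota_hom])
  next
    fix x y assume "x \<in> ?S" "y \<in> ?S"
    then obtain a b where "fourier n x * unitary_power V (- n) = \<iota> a"
      "fourier n y * unitary_power V (- n) = \<iota> b" by auto
    then have "fourier n (x + y) * unitary_power V (- n) = \<iota> (a + b)"
      by (simp add: linear_add bounded_linear.linear bounded_linear_fourier distrib_right
          unital_star_homD[OF iota_hom])
    then show "x + y \<in> ?S" by simp
  qed
  then obtain a where "fourier n x * unitary_power V (- n) = \<iota> a" by auto
  then have "fourier n x * (unitary_power V (- n) * unitary_power V n) = \<iota> a * unitary_power V n"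
    by (simp flip: mult.assoc)
  then show ?thesis by (auto simp: unitary_power_V_cancel)
qed

text \<open>On generators \<Phi> preserves degrees, so it commutes with every gauge automorphism;
  being bounded and linear, it then passes under the integral.\<close>

lemma fourier_commute:
  assumes \<Phi>: "unital_star_hom \<Phi>" and "\<And>a. \<exists>b. \<Phi> (\<iota> a) = \<iota> b" and "\<exists>b. \<Phi> V = \<iota> b * V"
  shows "\<Phi> (fourier n x) = fourier n (\<Phi> x)"
proof -
  note h = unital_star_homD[OF \<Phi>] and g = unital_star_homD[OF gauge_hom]
  have "(\<lambda>x. \<Phi> (gauge t x)) = (\<lambda>x. gauge t (\<Phi> x))" for t
  proof (rule hom_eqI)
    show "unital_star_hom (\<lambda>x. \<Phi> (gauge t x))" "unital_star_hom (\<lambda>x. gauge t (\<Phi> x))"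
      by (simp_all add: unital_star_hom_def h g)
    show "\<Phi> (gauge t (\<iota> a)) = gauge t (\<Phi> (\<iota> a))" for a
      using assms(2)[of a] by (auto simp: gauge_iota)
    show "\<Phi> (gauge t V) = gauge t (\<Phi> V)"
      using assms(3) by (auto simp: gauge_V gauge_iota h g mult_scaleC_right)
  qed
  then have comm: "\<Phi> (gauge t x) = gauge t (\<Phi> x)" for t by metis
  have "\<Phi> (integral {0..2 * pi} (\<lambda>t. cis (of_int (- n) * t) *\<^sub>C gauge t x)) =
      integral {0..2 * pi} (\<lambda>t. cis (of_int (- n) * t) *\<^sub>C gauge t (\<Phi> x))"
    using integral_linear[OF fourier_integrable[of "- n"] bounded_linear_star_hom[OF \<Phi>], of x]
    by (simp add: o_def h comm)
  then show ?thesis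
    by (simp add: fourier_def linear_scale bounded_linear.linear[OF bounded_linear_star_hom[OF \<Phi>]])
qed

section \<open>Fejer summation of the homogeneous components\<close>

definition fejer :: "nat \<Rightarrow> 'b \<Rightarrow> 'b"
  where "fejer N x = (1 / real N) *\<^sub>R (\<Sum>l<N. \<Sum>m<N. fourier (int l - int m) x)"

lemma bounded_linear_fejer: "bounded_linear (fejer N)"
  unfolding fejer_def[abs_def]
  by (intro bounded_linear_intros bounded_linear_sum bounded_linear_fourier
      bounded_linear.bounded_linear[OF bounded_linear_scaleR_right]
      bounded_linear_compose[OF bounded_linear_scaleR_right])

text \<open>For |n| < N the double sum meets degree n exactly N - |n| times, so \<open>fejer\<close>
  is the Cesaro mean. Arranged by pairs, its kernel appears as |k t|^2 / N, which is nonnegative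
  with mean 1 over a period; hence the contraction.\<close>

lemma norm_fejer_le: "norm (fejer N x) \<le> norm x"
proof (cases "N = 0")
  case False
  define k where "k t = (\<Sum>l<N. cis (real l * t))" for t
  have k: "cnj (k t) * k t = (\<Sum>l<N. \<Sum>m<N. cis (of_int (- (int l - int m)) * t))" for t
    unfolding k_def cnj_sum sum_product
    by (intro sum.cong) (simp_all add: cis_cnj cis_mult algebra_simps)
  from has_integral_sum[OF finite_lessThan, OF has_integral_sum[OF finite_lessThan, OF has_integral_cis_int]]
  have "((\<lambda>t. cnj (k t) * k t) has_integral (\<Sum>l<N. \<Sum>m<N. if l = m then of_real (2 * pi) else 0)) {0..2 * pi}"
    unfolding k by (rule back_subst) (simp cong: if_cong)
  then have "((\<lambda>t. cnj (k t) * k t) has_integral of_real (2 * pi * N)) {0..2 * pi}"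
    by (simp add: mult.commute)
  from has_integral_linear[OF this bounded_linear_Re]
  have K: "((\<lambda>t. (cmod (k t))\<^sup>2 * norm x) has_integral 2 * pi * N * norm x) {0..2 * pi}"
    by (intro has_integral_mult_left) (simp add: o_def cnj_mult_self)
  have "((\<lambda>t. cis (of_int n * t) *\<^sub>C gauge t x) has_integral (2 * pi) *\<^sub>R fourier (- n) x) {0..2 * pi}" for n
    using integrable_integral[OF fourier_integrable[of n x]] by (simp add: fourier_def)
  from has_integral_sum[OF finite_lessThan, OF has_integral_sum[OF finite_lessThan, OF this]]
  have "((\<lambda>t. (cnj (k t) * k t) *\<^sub>C gauge t x) has_integral
      (\<Sum>l<N. \<Sum>m<N. (2 * pi) *\<^sub>R fourier (- (- (int l - int m))) x)) {0..2 * pi}"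
    unfolding k bounded_linear.linear[OF bounded_linear_scaleC_left, THEN linear_sum] .
  then have I: "((\<lambda>t. (cnj (k t) * k t) *\<^sub>C gauge t x) has_integral (2 * pi * N) *\<^sub>R fejer N x) {0..2 * pi}"
    using False by (simp add: fejer_def scaleR_sum_right)
  have "norm ((2 * pi * N) *\<^sub>R fejer N x) \<le> 2 * pi * N * norm x"
    unfolding integral_unique[OF I, symmetric] integral_unique[OF K, symmetric]
  proof (rule integral_norm_bound_integral)
    fix t
    show "norm ((cnj (k t) * k t) *\<^sub>C gauge t x) \<le> (cmod (k t))\<^sup>2 * norm x"
      by (simp add: norm_scaleC norm_mult power2_eq_square mult_left_mono
          unital_star_hom_norm_le[OF gauge_hom])
  qed (use I K in \<open>auto simp: integrable_on_def\<close>)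
  then show ?thesis using False by simp
qed (simp add: fejer_def)

lemma fejer_basis_tendsto:
  "(\<lambda>N. fejer N (\<iota> a * unitary_power V n)) \<longlonglongrightarrow> \<iota> a * unitary_power V n"
proof -
  let ?y = "\<iota> a * unitary_power V n"
  define c where "c N = card {l. l < N \<and> 0 \<le> int l - n \<and> int l - n < int N}" for N
  have "(\<Sum>m<N. fourier (int l - int m) ?y) = (if 0 \<le> int l - n \<and> int l - n < int N then ?y else 0)"
    for l N
  proof -
    have "(\<Sum>m<N. fourier (int l - int m) ?y) = (\<Sum>m<N. if m = nat (int l - n) \<and> 0 \<le> int l - n then ?y else 0)"
      by (intro sum.cong) (auto simp: fourier_basis)
    then show ?thesis by (auto simp: sum.delta')
  qed
  then have "fejer N ?y = (1 / real N) *\<^sub>R (real (c N) *\<^sub>R ?y)" for N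
    by (simp add: fejer_def c_def sum.If_cases scaleR_conv_of_real Int_def lessThan_def)
  then have F: "fejer N ?y = (real (c N) / real N) *\<^sub>R ?y" for N by simp
  have up: "c N \<le> N" for N
    unfolding c_def using card_mono[of "{..<N}"] by (metis (no_types, lifting) card_lessThan finite_lessThan lessThan_iff mem_Collect_eq subsetI)
  \<comment> \<open>Trimming |n| at both ends keeps both l and l - n inside [0, N). The bound is
    crude, but an error of 2|n| vanishes after division by N.\<close>
  have "{nat \<bar>n\<bar>..<N - nat \<bar>n\<bar>} \<subseteq> {l. l < N \<and> 0 \<le> int l - n \<and> int l - n < int N}" for N
    by auto
  from card_mono[OF _ this] have lo: "N - 2 * nat \<bar>n\<bar> \<le> c N" for N
    unfolding c_def by (simp add: mult_2)
  have "(\<lambda>N. real (c N) / real N) \<longlonglongrightarrow> 1"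
  proof (rule tendsto_sandwich)
    show "\<forall>\<^sub>F N in sequentially. 1 - 2 * real (nat \<bar>n\<bar>) * (1 / real N) \<le> real (c N) / real N"
      using eventually_gt_at_top[of 0]
    proof eventually_elim
      case (elim N)
      have "real N - 2 * real (nat \<bar>n\<bar>) \<le> real (c N)" using lo[of N] by linarith
      then have "(real N - 2 * real (nat \<bar>n\<bar>)) / real N \<le> real (c N) / real N"
        by (rule divide_right_mono) simp
      with elim show ?case by (simp add: diff_divide_distrib)
    qed
    show "\<forall>\<^sub>F N in sequentially. real (c N) / real N \<le> 1"
      using up by (intro always_eventually) (auto simp: divide_le_eq)
    show "(\<lambda>N. 1 - 2 * real (nat \<bar>n\<bar>) * (1 / real N)) \<longlonglongrightarrow> 1"
      by (rule tendsto_eq_intros lim_1_over_n refl | simp)+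
  qed simp
  from tendsto_scaleR[OF this tendsto_const[of ?y]] show ?thesis by (simp add: F)
qed

text \<open>The maps \<open>fejer N\<close> are uniformly contractive, so the set on which they
  converge to the identity is closed, and it contains the monomials.\<close>

lemma fejer_tendsto: "(\<lambda>N. fejer N x) \<longlonglongrightarrow> x"
proof -
  let ?S = "{x. (\<lambda>N. fejer N x) \<longlonglongrightarrow> x}"
  have "x \<in> ?S"
  proof (rule closed_additive_set_contains)
    show "closed ?S"
      unfolding closure_subset_eq[symmetric]
    proof
      fix z assume z: "z \<in> closure ?S"
      show "z \<in> ?S"
        unfolding mem_Collect_eq
      proof (rule tendstoI)
        fix e :: real assume "e > 0"
        then obtain y where y: "y \<in> ?S" "dist y z < e / 3"
          using z unfolding closure_approachable by (metis divide_pos_pos zero_less_numeral)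
        then have "\<forall>\<^sub>F N in sequentially. dist (fejer N y) y < e / 3"
          using \<open>e > 0\<close> by (intro tendstoD) auto
        then show "\<forall>\<^sub>F N in sequentially. dist (fejer N z) z < e"
        proof eventually_elim
          case (elim N)
          have "dist (fejer N y) (fejer N z) \<le> dist y z"
            using norm_fejer_le[of N "y - z"]
            by (simp add: dist_norm linear_diff bounded_linear.linear bounded_linear_fejer)
          with elim y(2) dist_triangle[of "fejer N z" z y] dist_triangle[of "fejer N z" y "fejer N y"]
          show ?case by (simp add: dist_commute)
        qed
      qed
    qed
  qed (auto simp: fejer_basis_tendsto linear_add bounded_linear.linear bounded_linear_fejer
      intro: tendsto_add)
  then show ?thesis by simp
qed

text \<open>Each Fejer mean is a finite real combination of components, so membership passes to x
  without any claim that the Fourier series itself converges.\<close>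

lemma mem_if_fourier_mem:
  assumes "closed S" "subspace S" "\<And>n. fourier n x \<in> S"
  shows "x \<in> S"
proof (rule Lim_in_closed_set[OF assms(1) _ _ fejer_tendsto])
  show "\<forall>\<^sub>F N in sequentially. fejer N x \<in> S"
    using assms(2,3) by (auto simp: fejer_def intro!: always_eventually subspace_scale subspace_sum)
qed simp

end

section \<open>Continuous functions on the circle\<close>

lemma continuous_on_Rep_circle: "continuous_on S Rep_circle"
  unfolding continuous_on_iff dist_circle_def by blast

lemma continuous_on_Abs_circle: "continuous_on (sphere 0 1) Abs_circle"
  unfolding continuous_on_iff by (auto simp: dist_circle_def Abs_circle_inverse)

definition circle_coord :: "circle \<Rightarrow>\<^sub>C complex"
  where "circle_coord = Bcontfun Rep_circle"

lemma cmod_Rep_circle [simp]: "cmod (Rep_circle w) = 1"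
  using Rep_circle[of w] by simp

lemma apply_circle_coord [simp]: "apply_bcontfun circle_coord w = Rep_circle w"
  unfolding circle_coord_def
  by (subst Bcontfun_inverse) (auto intro!: bcontfun_normI[where b = 1] continuous_on_Rep_circle)

lemma unitary_circle_coord: "unitary circle_coord"
  by (auto simp: unitary_def star_complex_def cnj_mult_self mult.commute[of _ "cnj _"]
      intro!: bcontfun_eqI)

text \<open>Stone-Weierstrass: polynomials in Re z and Im z are dense, and both functions are
  combinations of the coordinate and its adjoint.\<close>

lemma closed_star_subalgebra_circle_coord:
  assumes S: "unital_star_subalgebra S" "closed S" and Z: "circle_coord \<in> S"
  shows "S = UNIV"
proof -
  have S1: "1 \<in> S" and Sadd: "\<And>x y. x \<in> S \<Longrightarrow> y \<in> S \<Longrightarrow> x + y \<in> S"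
    and Smult: "\<And>x y. x \<in> S \<Longrightarrow> y \<in> S \<Longrightarrow> x * y \<in> S"
    and Sscale: "\<And>c x. x \<in> S \<Longrightarrow> c *\<^sub>C x \<in> S" and Sstar: "\<And>x. x \<in> S \<Longrightarrow> star x \<in> S"
    using S(1) by (auto simp: unital_star_subalgebra_def)
  have poly: "\<exists>h\<in>S. \<forall>w. apply_bcontfun h w = of_real (p (Rep_circle w))"
    if "real_polynomial_function p" for p :: "complex \<Rightarrow> real"
    using that
  proof induction
    case (linear p)
    \<comment> \<open>Chosen so that c z + cnj c cnj z = 2 Re (c z) equals Re z p(1) + Im z p(i),
      which is p(z) by real linearity.\<close>
    let ?c = "Complex (p 1 / 2) (- p \<i> / 2)"
    have "p z = Re z * p 1 + Im z * p \<i>" for z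
    proof -
      have "z = Re z *\<^sub>R 1 + Im z *\<^sub>R \<i>" by (simp add: complex_eq_iff)
      then have "p z = p (Re z *\<^sub>R 1 + Im z *\<^sub>R \<i>)" by simp
      also have "\<dots> = Re z * p 1 + Im z * p \<i>"
        using bounded_linear.linear[OF linear] by (simp only: linear_add linear_scale real_scaleR_def)
      finally show ?thesis .
    qed
    then have "p (Rep_circle w) = Re (Rep_circle w) * p 1 + Im (Rep_circle w) * p \<i>" for w by blast
    then have "\<forall>w. apply_bcontfun (?c *\<^sub>C circle_coord + cnj ?c *\<^sub>C star circle_coord) w =
        of_real (p (Rep_circle w))"
      by (simp add: scaleC_complex_def star_complex_def complex_eq_iff)
    moreover have "?c *\<^sub>C circle_coord + cnj ?c *\<^sub>C star circle_coord \<in> S"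
      by (intro Sadd Sscale Sstar Z)
    ultimately show ?case by blast
  next
    case (const c)
    then show ?case
      using Sscale[OF S1, of "of_real c"] by (intro bexI) (auto simp: scaleC_complex_def)
  next
    case (add f g)
    then obtain h k where "h \<in> S" "\<forall>w. apply_bcontfun h w = of_real (f (Rep_circle w))"
      "k \<in> S" "\<forall>w. apply_bcontfun k w = of_real (g (Rep_circle w))" by blast
    then show ?case by (intro bexI[of _ "h + k"] Sadd) simp_all
  next
    case (mult f g)
    then obtain h k where "h \<in> S" "\<forall>w. apply_bcontfun h w = of_real (f (Rep_circle w))"
      "k \<in> S" "\<forall>w. apply_bcontfun k w = of_real (g (Rep_circle w))" by blast
    then show ?case by (intro bexI[of _ "h * k"] Smult) simp_all
  qed
  have "f \<in> closure S" for f
    unfolding closure_approachable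
  proof (intro allI impI)
    fix e :: real assume "e > 0"
    have "continuous_on (sphere 0 1) (\<lambda>z. apply_bcontfun f (Abs_circle z))"
      by (rule continuous_on_compose2[OF _ continuous_on_Abs_circle]) auto
    then obtain g where g: "polynomial_function g"
      "\<And>z. z \<in> sphere 0 1 \<Longrightarrow> cmod (apply_bcontfun f (Abs_circle z) - g z) < e / 2"
      using Stone_Weierstrass_polynomial_function[of "sphere 0 1" "\<lambda>z. apply_bcontfun f (Abs_circle z)" "e / 2"]
        \<open>e > 0\<close> by auto
    have gp: "real_polynomial_function (Re \<circ> g)" "real_polynomial_function (Im \<circ> g)"
      using g(1) by (simp_all add: polynomial_function_def bounded_linear_Re bounded_linear_Im)
    obtain h k where h: "h \<in> S" "\<And>w. apply_bcontfun h w = of_real (Re (g (Rep_circle w)))"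
      and k: "k \<in> S" "\<And>w. apply_bcontfun k w = of_real (Im (g (Rep_circle w)))"
      using poly[OF gp(1)] poly[OF gp(2)] unfolding comp_apply by blast
    have "cmod (apply_bcontfun (f - (h + \<i> *\<^sub>C k)) w) \<le> e / 2" for w
    proof -
      have "apply_bcontfun (h + \<i> *\<^sub>C k) w = g (Rep_circle w)"
        by (simp add: h k scaleC_complex_def flip: complex_eq)
      then show ?thesis
        using g(2)[OF Rep_circle, of w] by (simp add: Rep_circle_inverse)
    qed
    then have "norm (f - (h + \<i> *\<^sub>C k)) \<le> e / 2" by (rule norm_bound)
    then have "dist (h + \<i> *\<^sub>C k) f < e" using \<open>e > 0\<close> by (simp add: dist_norm norm_minus_commute)
    then show "\<exists>y\<in>S. dist y f < e" using h(1) k(1) by (blast intro: Sadd Sscale)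
  qed
  then show ?thesis using closure_closed[OF S(2)] by auto
qed

section \<open>Unitaries as covariant pairs for the trivial automorphism of the scalars\<close>

lemma scalar_hom: "unital_star_hom (\<lambda>c. c *\<^sub>C (1 :: 'b::unital_cstar_algebra))"
  by (simp add: unital_star_hom_def scaleC_add_left scaleC_complex_def scaleC_scaleC mult_scaleC_left
      star_complex_def star_scaleC)

lemma covariant_pair_scalar:
  "unitary W \<Longrightarrow> covariant_pair id (\<lambda>c. c *\<^sub>C (1 :: 'b::unital_cstar_algebra)) W"
  unfolding covariant_pair_def by (simp add: scalar_hom mult_scaleC_left mult_scaleC_right unitary_def)

lemma star_automorphism_id: "star_automorphism id"
  by (simp add: star_automorphism_def unital_star_hom_def)

lemma int_funpow_id [simp]: "int_funpow id n = id"
proof -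
  have "(id :: 'a \<Rightarrow> 'a) ^^ k = id" for k by (induction k) simp_all
  then show ?thesis by (simp add: int_funpow_def inv_id)
qed

lemma power_two_power_Suc: "x ^ (2 ^ Suc m) = (x ^ (2 ^ m))\<^sup>2" for x :: "'a::monoid_mult"
  by (simp add: mult.commute flip: power_mult)

text \<open>If a > b, then (c n + 1) (b/a)^n tends to 0 along n = 2^m although it stays at least 1:
  a linear factor is invisible to 2^m-th roots.\<close>

lemma power_growth_le:
  fixes a b c :: real
  assumes "0 \<le> a" "0 \<le> b" and le: "\<And>m. a ^ (2 ^ m) \<le> (c * 2 ^ m + 1) * b ^ (2 ^ m)"
  shows "a \<le> b"
proof (rule ccontr)
  assume "\<not> a \<le> b"
  then have "a > 0" and q: "norm (b / a) < 1" using assms(2) by auto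
  have "(\<lambda>n. c * (real n * (b / a) ^ n) + (b / a) ^ n) \<longlonglongrightarrow> c * 0 + 0"
    using q by (intro tendsto_intros powser_times_n_limit_0 LIMSEQ_power_zero)
  moreover have "strict_mono (\<lambda>m. 2 ^ m :: nat)" by (simp add: strict_mono_def)
  ultimately have "(\<lambda>m. c * (real (2 ^ m) * (b / a) ^ (2 ^ m)) + (b / a) ^ (2 ^ m)) \<longlonglongrightarrow> c * 0 + 0"
    by (rule LIMSEQ_subseq_LIMSEQ[unfolded o_def])
  moreover have "1 \<le> c * (real (2 ^ m) * (b / a) ^ (2 ^ m)) + (b / a) ^ (2 ^ m)" for m
    using le[of m] \<open>a > 0\<close> by (simp add: power_divide field_simps)
  ultimately have "1 \<le> c * 0 + (0 :: real)" by (intro Lim_bounded2) auto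
  then show False by simp
qed

section \<open>C*-seminorms on Laurent polynomials\<close>

context
  fixes p :: "(int \<Rightarrow> complex) \<Rightarrow> real"
  assumes p: "cstar_seminorm id p"
begin

lemma cstar_seminorm_id_rules:
  assumes "finitely_supported f"
  shows "finitely_supported g \<Longrightarrow> p (\<lambda>n. f n + g n) \<le> p f + p g"
    and "p (\<lambda>n. c *\<^sub>C f n) = cmod c * p f"
    and "p (twisted_mult id (twisted_star id f) f) = (p f)\<^sup>2"
  using p assms by (simp_all add: cstar_seminorm_def)

lemma cstar_seminorm_id_zero: "p (\<lambda>n. 0) = 0"
proof -
  have "finitely_supported (\<lambda>n. 0 :: complex)" by (simp add: finitely_supported_def)
  from cstar_seminorm_id_rules(2)[OF this, of 0] show ?thesis by simp
qed

lemma cstar_seminorm_id_nonneg: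
  assumes f: "finitely_supported f"
  shows "0 \<le> p f"
  using cstar_seminorm_id_rules(1)[OF f finitely_supported_scaleC[OF f], of "-1"]
    cstar_seminorm_id_rules(2)[OF f, of "-1"]
  by (simp add: scaleC_minus_one cstar_seminorm_id_zero)

text \<open>A monomial with coefficient 1 times its adjoint is the unit, where p equals its own
  square and so is 0 or 1. A seminorm may take the value 0, hence only an inequality.\<close>

lemma cstar_seminorm_id_single: "p (\<lambda>n. if n = k then a else 0) \<le> cmod a"
proof -
  let ?e = "\<lambda>k n :: int. if n = k then 1 else (0 :: complex)"
  have fin: "finitely_supported (?e k)" for k
    by (rule integrated_form_single(2)[OF scalar_hom])
  have "twisted_mult id (twisted_star id (?e k)) (?e k) = ?e 0" for k
  proof -
    have "twisted_star id (?e k) = ?e (- k)"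
      by (auto simp: twisted_star_def star_complex_def fun_eq_iff)
    moreover have "{n. ?e (- k) n \<noteq> 0} = {- k}" by auto
    ultimately show ?thesis by (auto simp: twisted_mult_def fun_eq_iff)
  qed
  then have sq: "(p (?e k))\<^sup>2 = p (?e 0)" for k
    using cstar_seminorm_id_rules(3)[OF fin] by metis
  have "p (?e 0) \<le> 1"
    using sq[of 0] by (auto simp: power2_eq_square)
  then have "(p (?e k))\<^sup>2 \<le> 1\<^sup>2" using sq[of k] by simp
  then have le1: "p (?e k) \<le> 1" by (rule power2_le_imp_le) simp
  have "p (\<lambda>n. a *\<^sub>C ?e k n) = cmod a * p (?e k)"
    by (rule cstar_seminorm_id_rules(2)[OF fin])
  moreover have "(\<lambda>n. a *\<^sub>C ?e k n) = (\<lambda>n. if n = k then a else 0)"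
    by (auto simp: scaleC_complex_def)
  ultimately show ?thesis using le1 by (simp add: mult_left_le)
qed

lemma cstar_seminorm_id_le_sum:
  assumes "finite A" "{n. f n \<noteq> 0} \<subseteq> A"
  shows "p f \<le> (\<Sum>n\<in>A. cmod (f n))"
proof -
  have "p (\<lambda>n. if n \<in> A then f n else 0) \<le> (\<Sum>n\<in>A. cmod (f n))"
    using assms(1)
  proof induction
    case (insert k A)
    let ?g = "\<lambda>n. if n \<in> A then f n else 0" and ?h = "\<lambda>n. if n = k then f k else 0"
    have "finitely_supported ?g"
      unfolding finitely_supported_def by (rule finite_subset[OF _ insert(1)]) auto
    then have "p (\<lambda>n. ?g n + ?h n) \<le> p ?g + p ?h"
      by (rule cstar_seminorm_id_rules(1)) (rule integrated_form_single(2)[OF scalar_hom])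
    moreover have "(\<lambda>n. ?g n + ?h n) = (\<lambda>n. if n \<in> insert k A then f n else 0)"
      using insert(2) by auto
    ultimately show ?case using insert cstar_seminorm_id_single[of k "f k"] by simp
  qed (simp add: cstar_seminorm_id_zero)
  moreover have "(\<lambda>n. if n \<in> A then f n else 0) = f" using assms(2) by (auto simp: fun_eq_iff)
  ultimately show ?thesis by simp
qed

text \<open>Both seminorms satisfy the $C^*$-identity, hence are multiplicative on the powers
  $h^{2^m}$ of $h = f^*f$. The number of coefficients of $h^{2^m}$ grows only linearly in $2^m$,
  so comparing both sides with the coefficients loses nothing after taking $2^m$-th roots.\<close>

lemma cstar_seminorm_id_le_norm:
  fixes W :: "'b::unital_cstar_algebra"
  assumes W: "unitary W"
    and coeff: "\<And>f n. finitely_supported f \<Longrightarrow> cmod (f n) \<le> norm (integrated_form (\<lambda>c. c *\<^sub>C 1) W f)"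
    and f: "finitely_supported f"
  shows "p f \<le> norm (integrated_form (\<lambda>c. c *\<^sub>C 1) W f)"
proof -
  let ?I = "integrated_form (\<lambda>c. c *\<^sub>C 1) W"
  note cov = covariant_pair_scalar[OF W]
  define x where "x = ?I f"
  define h where "h m = ((\<lambda>k. twisted_mult id k k) ^^ m) (twisted_mult id (twisted_star id f) f)" for m
  have h0: "h 0 = twisted_mult id (twisted_star id f) f"
    and hS: "h (Suc m) = twisted_mult id (h m) (h m)" for m by (simp_all add: h_def)
  have fin: "finitely_supported (h m)" for m
    by (induction m) (simp_all add: h0 hS f finitely_supported_twisted_mult star_automorphism_id
        finitely_supported_twisted_star)
  have Ih: "?I (h m) = (star x * x) ^ (2 ^ m)" for m
    by (induction m) (simp_all add: h0 hS f fin integrated_form_twisted_mult[OF star_automorphism_id _ _ cov]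
        integrated_form_twisted_star[OF star_automorphism_id _ cov] x_def star_automorphism_id
        finitely_supported_twisted_star power_two_power_Suc power2_eq_square del: power_Suc)
  \<comment> \<open>The coefficient bound makes \<open>?I\<close> injective, so self-adjointness of
    \<open>h m\<close> can be read off from its image.\<close>
  have inj: "k = l" if k: "finitely_supported k" and l: "finitely_supported l" and "?I k = ?I l" for k l
  proof
    fix n
    note l' = finitely_supported_scaleC[OF l, of "-1"]
    have "?I (\<lambda>n. k n + (-1) *\<^sub>C l n) = 0"
      using that(3) by (simp only: integrated_form_add[OF k l' scalar_hom] integrated_form_scaleC[OF l scalar_hom])
        (simp add: scaleC_minus_one)
    then show "k n = l n"
      using coeff[OF finitely_supported_add[OF k l'], of n] by (simp add: scaleC_minus_one)
  qed
  have sp: "star (y ^ k) = star y ^ k" for y :: 'b and k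
    by (induction k) (simp_all add: star_mult power_commutes)
  have "twisted_star id (h m) = h m" for m
    by (rule inj) (simp_all add: fin finitely_supported_twisted_star star_automorphism_id Ih sp star_mult
        star_star integrated_form_twisted_star[OF star_automorphism_id _ cov])
  then have "p (h (Suc m)) = (p (h m))\<^sup>2" for m
    using cstar_seminorm_id_rules(3)[OF fin] unfolding hS by metis
  then have ph: "p (h m) = p (h 0) ^ (2 ^ m)" for m
    by (induction m) (simp_all only: power_two_power_Suc power_0 power_one_right)
  have "norm ((star x * x) ^ (2 ^ m)) = norm (star x * x) ^ (2 ^ m)" for m
  proof (induction m)
    case (Suc m)
    let ?y = "(star x * x) ^ (2 ^ m)"
    have "star ?y = ?y" by (simp add: sp star_mult star_star)
    then have "(star x * x) ^ (2 ^ Suc m) = star ?y * ?y"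
      by (simp only: power_two_power_Suc power2_eq_square)
    then have "norm ((star x * x) ^ (2 ^ Suc m)) = (norm ?y)\<^sup>2"
      by (simp only: norm_star_mult_self)
    with Suc show ?case by (simp only: power_two_power_Suc)
  qed simp
  then have Inorm: "norm (?I (h m)) = norm (star x * x) ^ (2 ^ m)" for m by (simp add: Ih)
  have supp_mult: "\<bar>n\<bar> \<le> a + b"
    if "twisted_mult id k l n \<noteq> 0" "\<And>n. k n \<noteq> 0 \<Longrightarrow> \<bar>n\<bar> \<le> a" "\<And>n. l n \<noteq> 0 \<Longrightarrow> \<bar>n\<bar> \<le> b"
    for k l :: "int \<Rightarrow> complex" and n a b :: int
  proof -
    have "(\<Sum>i | k i \<noteq> 0. k i * l (n - i)) \<noteq> 0" using that(1) by (simp add: twisted_mult_def)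
    then obtain i where "i \<in> {i. k i \<noteq> 0}" "k i * l (n - i) \<noteq> 0"
      by (rule sum.not_neutral_contains_not_neutral)
    then have "\<bar>i\<bar> \<le> a" "\<bar>n - i\<bar> \<le> b" using that(2,3) by auto
    then show ?thesis by linarith
  qed
  obtain R where R: "\<And>n. f n \<noteq> 0 \<Longrightarrow> \<bar>n\<bar> \<le> R" "R \<ge> 0"
  proof
    \<comment> \<open>The inserted 0 keeps the maximum defined when f vanishes and makes R
      nonnegative.\<close>
    let ?R = "Max (insert 0 (abs ` {n. f n \<noteq> 0}))"
    show "\<bar>n\<bar> \<le> ?R" if "f n \<noteq> 0" for n
      using f that by (intro Max_ge) (auto simp: finitely_supported_def)
    show "?R \<ge> 0" using f by (intro Max_ge) (auto simp: finitely_supported_def)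
  qed
  have supp: "\<bar>n\<bar> \<le> 2 * R * 2 ^ m" if "h m n \<noteq> 0" for m n
    using that
  proof (induction m arbitrary: n)
    case 0
    have "\<bar>n\<bar> \<le> R + R"
    proof (rule supp_mult)
      show "twisted_mult id (twisted_star id f) f n \<noteq> 0" using 0 by (simp add: h0)
      show "\<bar>n\<bar> \<le> R" if "twisted_star id f n \<noteq> 0" for n
        using that R(1)[of "- n"] by (auto simp: twisted_star_def star_complex_def)
    qed (rule R)
    then show ?case by simp
  next
    case (Suc m)
    have "\<bar>n\<bar> \<le> 2 * R * 2 ^ m + 2 * R * 2 ^ m"
      by (rule supp_mult[of "h m" "h m"]) (use Suc in \<open>auto simp: hS\<close>)
    then show ?case by simp
  qed
  have "p (h 0) \<le> norm (star x * x)"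
  proof (rule power_growth_le)
    fix m
    \<comment> \<open>By \<open>supp\<close> this interval carries all coefficients of
      \<open>h m\<close>. It has 4 R 2^m + 1 points, the linear factor allowed by
      \<open>power_growth_le\<close>.\<close>
    let ?A = "{- (2 * R * 2 ^ m)..2 * R * 2 ^ m}"
    have "p (h m) \<le> (\<Sum>n\<in>?A. cmod (h m n))"
      by (rule cstar_seminorm_id_le_sum) (use supp[of m] in \<open>force simp: abs_le_iff\<close>)+
    also have "\<dots> \<le> (\<Sum>n\<in>?A. norm (?I (h m)))" by (intro sum_mono coeff fin)
    also have "\<dots> = (4 * R * 2 ^ m + 1) * norm (star x * x) ^ (2 ^ m)"
      using R(2) by (simp add: Inorm)
    finally show "p (h 0) ^ (2 ^ m) \<le> (real_of_int (4 * R) * 2 ^ m + 1) * norm (star x * x) ^ (2 ^ m)"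
      unfolding ph[of m, symmetric] by simp
  qed (use cstar_seminorm_id_nonneg fin in auto)
  moreover have "p (h 0) = (p f)\<^sup>2" by (simp add: h0 cstar_seminorm_id_rules(3)[OF f])
  ultimately have "(p f)\<^sup>2 \<le> (norm x)\<^sup>2" by (simp add: norm_star_mult_self)
  then show ?thesis unfolding x_def by (rule power2_le_imp_le) simp
qed

end

text \<open>The coefficient is the mean of the function against \<open>cis (- of_int n * t)\<close>,
  so the supremum norm bounds it.\<close>

lemma circle_coord_coefficient_le:
  assumes f: "finitely_supported f"
  shows "cmod (f n) \<le> norm (integrated_form (\<lambda>c. c *\<^sub>C 1) circle_coord f)"
proof -
  let ?F = "integrated_form (\<lambda>c. c *\<^sub>C 1) circle_coord f" and ?A = "{n. f n \<noteq> 0}"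
  have ap: "apply_bcontfun (g ^ k) w = apply_bcontfun g w ^ k" for g :: "circle \<Rightarrow>\<^sub>C complex" and w k
    by (induction k) simp_all
  have "apply_bcontfun (unitary_power circle_coord k) (Abs_circle (cis t)) = cis (of_int k * t)" for k t
    by (simp add: unitary_power_def ap star_complex_def cis_cnj Complex.DeMoivre Abs_circle_inverse)
  then have "apply_bcontfun ?F (Abs_circle (cis t)) = (\<Sum>k\<in>?A. f k * cis (of_int k * t))" for t
    by (simp add: integrated_form_def bounded_linear.linear[OF bounded_linear_apply_bcontfun, THEN linear_sum]
        scaleC_complex_def mult_scaleC_left)
  then have ev: "cmod (\<Sum>k\<in>?A. f k * cis (of_int k * t)) \<le> norm ?F" for t
    using norm_bounded[of ?F] by metis
  from has_integral_sum[OF _ has_integral_mult_right[OF has_integral_cis_int]]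
  have "((\<lambda>t. \<Sum>k\<in>?A. f k * cis (of_int (k - n) * t)) has_integral
      (\<Sum>k\<in>?A. f k * (if k - n = 0 then of_real (2 * pi) else 0))) {0..2 * pi}"
    using f unfolding finitely_supported_def .
  also have "(\<Sum>k\<in>?A. f k * (if k - n = 0 then of_real (2 * pi) else 0)) = f n * of_real (2 * pi)"
    using f by (auto simp: finitely_supported_def if_distrib cong: if_cong)
  finally have I: "((\<lambda>t. \<Sum>k\<in>?A. f k * cis (of_int (k - n) * t)) has_integral f n * of_real (2 * pi)) {0..2 * pi}" .
  have "cmod (\<Sum>k\<in>?A. f k * cis (of_int (k - n) * t)) \<le> norm ?F" for t
  proof -
    have "(\<Sum>k\<in>?A. f k * cis (of_int (k - n) * t)) = (\<Sum>k\<in>?A. f k * cis (of_int k * t)) * cis (- of_int n * t)"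
      unfolding sum_distrib_right mult.assoc cis_mult by (simp add: algebra_simps)
    with ev[of t] show ?thesis by (simp add: norm_mult)
  qed
  then have "cmod (f n * of_real (2 * pi)) \<le> integral {0..2 * pi} (\<lambda>t. norm ?F)"
    unfolding integral_unique[OF I, symmetric]
    by (intro integral_norm_bound_integral) (use I in \<open>auto simp: integrable_on_def\<close>)
  then show ?thesis by (simp add: norm_mult)
qed

text \<open>Generation is Stone-Weierstrass; maximality of the sup norm is the seminorm comparison
  fed with the coefficient bound. Homomorphisms out of C(T) then come from the universal
  property.\<close>

lemma universal_crossed_product_circle:
  "universal_crossed_product id (\<lambda>c. c *\<^sub>C 1) circle_coord"
proof -
  have inj: "inj (\<lambda>c. c *\<^sub>C (1 :: circle \<Rightarrow>\<^sub>C complex))"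
  proof (rule injI)
    fix c d assume "c *\<^sub>C (1 :: circle \<Rightarrow>\<^sub>C complex) = d *\<^sub>C 1"
    then have "apply_bcontfun (c *\<^sub>C (1 :: circle \<Rightarrow>\<^sub>C complex)) undefined = apply_bcontfun (d *\<^sub>C 1) undefined"
      by simp
    then show "c = d" by (simp add: scaleC_complex_def)
  qed
  have gen: "generated_cstar_subalgebra (range (\<lambda>c. c *\<^sub>C 1) \<union> {circle_coord}) = UNIV"
    unfolding generated_cstar_subalgebra_def
  proof (rule Inter_UNIV_conv(1)[THEN iffD2], intro ballI)
    fix S assume "S \<in> {S. range (\<lambda>c. c *\<^sub>C 1) \<union> {circle_coord} \<subseteq> S \<and> unital_star_subalgebra S \<and> closed S}"
    then show "S = UNIV" by (intro closed_star_subalgebra_circle_coord) auto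
  qed
  have cov: "covariant_pair id (\<lambda>c. c *\<^sub>C 1) circle_coord"
    by (rule covariant_pair_scalar[OF unitary_circle_coord])
  have max: "\<forall>p f. cstar_seminorm id p \<longrightarrow> finitely_supported f \<longrightarrow>
      p f \<le> norm (integrated_form (\<lambda>c. c *\<^sub>C 1) circle_coord f)"
  proof (rule allI)
    fix p :: "(int \<Rightarrow> complex) \<Rightarrow> real"
    show "\<forall>f. cstar_seminorm id p \<longrightarrow> finitely_supported f \<longrightarrow>
        p f \<le> norm (integrated_form (\<lambda>c. c *\<^sub>C 1) circle_coord f)"
      using cstar_seminorm_id_le_norm[of p, OF _ unitary_circle_coord circle_coord_coefficient_le]
      by simp
  qed
  show ?thesis
    unfolding universal_crossed_product_def by (rule conjI[OF cov conjI[OF inj conjI[OF gen max]]])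
qed

text \<open>The coefficient hypothesis stands in for W having full spectrum. It lets the seminorm
  comparison run with the sup norm as the smaller side, so no norm is lost on the dense Laurent
  polynomials.\<close>

lemma circle_star_hom_exists:
  fixes W :: "'b::unital_cstar_algebra"
  assumes W: "unitary W"
    and coeff: "\<And>f n. finitely_supported f \<Longrightarrow> cmod (f n) \<le> norm (integrated_form (\<lambda>c. c *\<^sub>C 1) W f)"
  shows "\<exists>\<Psi> :: (circle \<Rightarrow>\<^sub>C complex) \<Rightarrow> 'b. unital_star_hom \<Psi> \<and> (\<forall>f. norm (\<Psi> f) = norm f) \<and> \<Psi> circle_coord = W"
proof -
  let ?I = "integrated_form (\<lambda>c. c *\<^sub>C 1) circle_coord"
  note cov = covariant_pair_scalar[OF W]
  obtain \<Psi> :: "(circle \<Rightarrow>\<^sub>C complex) \<Rightarrow> 'b" where \<Psi>: "unital_star_hom \<Psi>" "\<And>c. \<Psi> (c *\<^sub>C 1) = c *\<^sub>C 1" "\<Psi> circle_coord = W"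
    using universal_crossed_product_hom[OF star_automorphism_id universal_crossed_product_circle cov] by blast
  note h = unital_star_homD[OF \<Psi>(1)]
  have pow: "\<Psi> (x ^ k) = \<Psi> x ^ k" for x k by (induction k) (simp_all add: h)
  have "\<Psi> (unitary_power circle_coord k) = unitary_power W k" for k
    by (simp add: unitary_power_def pow h(4) \<Psi>)
  then have I: "\<Psi> (?I f) = integrated_form (\<lambda>c. c *\<^sub>C 1) W f" for f
    by (simp add: integrated_form_def h(3,7) \<Psi>)
  have "closed {f. norm f \<le> norm (\<Psi> f)}"
    by (intro closed_Collect_le continuous_on_norm continuous_on_id linear_continuous_on
        bounded_linear_star_hom[OF \<Psi>(1)])
  moreover have "?I ` {f. finitely_supported f} \<subseteq> {f. norm f \<le> norm (\<Psi> f)}"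
    using cstar_seminorm_id_le_norm[OF cstar_seminorm_covariant_pair[OF star_automorphism_id
          covariant_pair_scalar[OF unitary_circle_coord]] W coeff]
    by (auto simp: I)
  ultimately have "closure (?I ` {f. finitely_supported f}) \<subseteq> {f. norm f \<le> norm (\<Psi> f)}"
    by (intro closure_minimal)
  then have "norm f \<le> norm (\<Psi> f)" for f
    using universal_crossed_product_dense[OF star_automorphism_id universal_crossed_product_circle] by auto
  then have "norm (\<Psi> f) = norm f" for f
    using unital_star_hom_norm_le[OF \<Psi>(1), of f] by (rule antisym[rotated])
  with \<Psi>(1,3) show ?thesis by blast
qed

section \<open>Fixed points of the skew product\<close>

lemma closed_range_isometric:
  fixes f :: "'a::banach \<Rightarrow> 'b::real_normed_vector"
  assumes "bounded_linear f" "\<And>x. norm (f x) = norm x"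
  shows "closed (range f)"
proof -
  have "complete (range f)"
    by (rule complete_isometric_image[of 1]) (simp_all add: assms complete_UNIV)
  then show ?thesis by (rule complete_imp_closed)
qed

lemma subspace_range: "bounded_linear f \<Longrightarrow> subspace (range f)"
  by (rule linear_subspace_image) (simp_all add: bounded_linear.linear)

lemma unital_star_subalgebra_fixed_points:
  assumes "\<And>g. unital_star_hom (\<Phi> g)"
  shows "unital_star_subalgebra (fixed_points \<Phi>)" "closed (fixed_points \<Phi>)"
proof -
  show "unital_star_subalgebra (fixed_points \<Phi>)"
    by (simp add: unital_star_subalgebra_def fixed_points_def unital_star_homD[OF assms])
  have "closed {b. \<Phi> g b = b}" for g
    by (intro closed_Collect_eq linear_continuous_on bounded_linear_star_hom assms continuous_on_id)
  then have "closed (\<Inter>g. {b. \<Phi> g b = b})" by blast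
  moreover have "(\<Inter>g. {b. \<Phi> g b = b}) = fixed_points \<Phi>" by (auto simp: fixed_points_def)
  ultimately show "closed (fixed_points \<Phi>)" by simp
qed

lemma unitary_mult: "unitary v \<Longrightarrow> unitary w \<Longrightarrow> unitary (v * w)"
  unfolding unitary_def star_mult by (metis mult.assoc mult.right_neutral)

lemma unitary_star: "unitary v \<Longrightarrow> unitary (star v)"
  by (simp add: unitary_def star_star)

lemma unitary_unitary_power: "unitary v \<Longrightarrow> unitary (unitary_power v n)"
  unfolding unitary_def star_unitary_power
  by (simp add: unitary_def flip: unitary_power_add)

text \<open>The isomorphism is expressed as an injective homomorphism into the ambient algebra with
  the fixed points as image, so the subalgebra need not become a type.\<close>

theorem proposition3p6:
  fixes \<theta> :: "'g::{topological_group_add, t2_space, second_countable_topology} \<Rightarrow>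
      ('x::metric_space \<Rightarrow>\<^sub>C complex) \<Rightarrow> ('x \<Rightarrow>\<^sub>C complex)"
    and \<alpha> :: "('x \<Rightarrow>\<^sub>C complex) \<Rightarrow> ('x \<Rightarrow>\<^sub>C complex)"
    and u :: "'g \<Rightarrow> ('x \<Rightarrow>\<^sub>C complex)"
    and \<iota> :: "('x \<Rightarrow>\<^sub>C complex) \<Rightarrow> 'b::unital_cstar_algebra"
    and V :: 'b
    and \<Phi> :: "'g \<Rightarrow> 'b \<Rightarrow> 'b"
  assumes "compact (UNIV :: 'x set)"
    and "locally_compact_space (euclidean :: 'g topology)"
    and "unimodular_group TYPE('g)"
    and "amenable_group TYPE('g)"
    and "cstar_dynamical_system \<theta>"
    and "uniquely_ergodic \<theta>"
    and "star_automorphism \<alpha>"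
    and "\<And>g. \<alpha> \<circ> \<theta> g = \<theta> g \<circ> \<alpha>"
    and "continuous_cocycle \<theta> u"
    and "universal_crossed_product \<alpha> \<iota> V"
    and "skew_product \<theta> u \<iota> V \<Phi>"
    and "\<not> weakly_ergodic \<Phi>"
  shows "\<exists>\<Psi> :: (circle \<Rightarrow>\<^sub>C complex) \<Rightarrow> 'b.
    unital_star_hom \<Psi> \<and> bij_betw \<Psi> UNIV (fixed_points \<Phi>)"
proof -
  interpret crossed_product \<alpha> \<iota> V
    using assms by unfold_locales
  note hom_iota = unital_star_homD[OF iota_hom]
  have inj: "inj \<iota>" using universal by (simp add: universal_crossed_product_def)
  have closed_iota: "closed (range \<iota>)"
    by (rule closed_range_isometric) (simp_all add: bounded_linear_star_hom iota_hom
        inj_star_hom_bcontfun_isometric inj)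
  have \<Phi>: "unital_star_hom (\<Phi> g)" and \<Phi>_iota: "\<Phi> g (\<iota> a) = \<iota> (\<theta> g a)"
    and \<Phi>_V: "\<Phi> g V = \<iota> (u g) * V" for g a
    using assms(11) by (simp_all add: skew_product_def star_automorphism_def)
  define F where "F = fixed_points \<Phi>"
  have F_alg: "unital_star_subalgebra F" and F_closed: "closed F"
    using unital_star_subalgebra_fixed_points[OF \<Phi>] by (simp_all add: F_def)
  then have F1: "1 \<in> F" and Fmult: "\<And>x y. x \<in> F \<Longrightarrow> y \<in> F \<Longrightarrow> x * y \<in> F"
    and Fscale: "\<And>c x. x \<in> F \<Longrightarrow> c *\<^sub>C x \<in> F" and Fstar: "\<And>x. x \<in> F \<Longrightarrow> star x \<in> F"
    by (auto simp: unital_star_subalgebra_def)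
  have F_iota: "\<exists>c. a = c *\<^sub>C 1" if "\<iota> a \<in> F" for a
  proof (rule uniquely_ergodic_fixed_point_scalar[OF assms(4-6)])
    show "a \<in> fixed_points \<theta>"
      using that inj by (auto simp: F_def fixed_points_def \<Phi>_iota inj_eq)
  qed
  define S where "S n = {y \<in> F. \<exists>a. y = \<iota> a * unitary_power V n}" for n
  have fourier_S: "fourier n x \<in> S n" if "x \<in> F" for n x
  proof -
    have "\<Phi> g (fourier n x) = fourier n x" for g
      using fourier_commute[OF \<Phi>, of g n x] that by (auto simp: \<Phi>_iota \<Phi>_V F_def fixed_points_def)
    then show ?thesis
      using fourier_in_range[OF closed_iota, of n x] by (simp add: S_def F_def fixed_points_def)
  qed
  have S_mult: "y * z \<in> S (m + n)" if "y \<in> S m" "z \<in> S n" for y z m n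
    using that unfolding S_def by (auto simp: basis_mult intro: Fmult)
  have S_star: "star y \<in> S (- n)" if "y \<in> S n" for y n
    using that unfolding S_def by (auto simp: basis_star intro: Fstar)
  have S_scale: "c *\<^sub>C y \<in> S n" if "y \<in> S n" for c y n
    using that unfolding S_def by (auto intro: Fscale) (metis hom_iota(2) mult_scaleC_left)
  have S_0: "\<exists>c. y = c *\<^sub>C 1" if "y \<in> S 0" for y
    using that F_iota unfolding S_def by (auto simp: hom_iota dest!: F_iota)
  \<comment> \<open>For fixed $y = a V^n$ both $y y^*$ and $y^* y$ are fixed points in $\iota(\mathfrak A)$,
    hence scalars.\<close>
  have S_unitary: "\<exists>w\<in>S n. unitary w" if y: "y \<in> S n" "y \<noteq> 0" for y n
  proof -
    obtain a where a: "y = \<iota> a * unitary_power V n" using y(1) by (auto simp: S_def)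
    have "y * star y = \<iota> (a * star a)"
    proof -
      have "y * star y = \<iota> a * (unitary_power V n * unitary_power V (- n)) * star (\<iota> a)"
        by (simp add: a star_mult star_unitary_power mult.assoc)
      then show ?thesis by (simp add: unitary_power_V_cancel hom_iota)
    qed
    moreover have "y * star y \<in> F" using y(1) by (auto simp: S_def intro: Fmult Fstar)
    ultimately obtain c where c: "a * star a = c *\<^sub>C 1" "y * star y = c *\<^sub>C 1"
      using F_iota[of "a * star a"] by (auto simp: hom_iota)
    \<comment> \<open>A point value shows that c is real and nonnegative; the C*-identity then
      identifies it as the square of the norm of y, which fixes the normalisation of
      \<open>?w\<close>.\<close>
    have "apply_bcontfun (a * star a) undefined = of_real ((cmod (apply_bcontfun a undefined))\<^sup>2)"
      by (simp add: star_complex_def complex_norm_square del: of_real_power)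
    then have "c = of_real ((cmod (apply_bcontfun a undefined))\<^sup>2)"
      by (simp add: c scaleC_complex_def)
    then obtain r where r: "c = of_real r" "r \<ge> 0" using zero_le_power2 by blast
    have "norm (y * star y) = (norm y)\<^sup>2" using norm_star_mult_self[of "star y"] by (simp add: star_star)
    then have cn: "c = of_real ((norm y)\<^sup>2)" using r by (simp add: c norm_scaleC)
    obtain d where d: "star y * y = d *\<^sub>C 1"
      using S_0 S_mult[OF S_star[OF y(1)] y(1)] by auto
    \<comment> \<open>Associating \<open>y * star y * y\<close> in two ways compares the two
      scalars, and y is nonzero.\<close>
    have "c *\<^sub>C y = (y * star y) * y" by (simp add: c mult_scaleC_left)
    also have "\<dots> = d *\<^sub>C y" by (simp add: mult.assoc d mult_scaleC_right)
    finally have "(c - d) *\<^sub>C y = 0"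
      using linear_diff[OF bounded_linear.linear[OF bounded_linear_scaleC_left[of y]], of c d] by simp
    then have "cmod (c - d) * norm y = 0" by (simp flip: norm_scaleC)
    then have "d = c" using y(2) by simp
    let ?w = "of_real (1 / norm y) *\<^sub>C y"
    have "unitary ?w"
      using y(2) by (simp add: unitary_def star_scaleC mult_scaleC_left mult_scaleC_right scaleC_scaleC
          c(2) d \<open>d = c\<close> cn power2_eq_square)
    then show ?thesis using S_scale[OF y(1)] by blast
  qed
  define H where "H = {n. \<exists>w\<in>S n. unitary w}"
  have H_nontrivial: "\<exists>n\<in>H. n \<noteq> 0"
  proof (rule ccontr)
    assume *: "\<not> (\<exists>n\<in>H. n \<noteq> 0)"
    let ?C = "range (\<lambda>c. c *\<^sub>C (1 :: 'b))"
    have "x \<in> ?C" if "x \<in> F" for x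
    proof (rule mem_if_fourier_mem)
      show "closed ?C"
        by (rule closed_range_isometric[OF bounded_linear_scaleC_left]) (simp add: norm_scaleC)
      show "subspace ?C" by (rule subspace_range[OF bounded_linear_scaleC_left])
      show "fourier n x \<in> ?C" for n
      proof (cases "n = 0")
        case True
        then show ?thesis using S_0 fourier_S[OF that, of 0] by auto
      next
        case False
        then have "fourier n x = 0"
          using * S_unitary[OF fourier_S[OF that, of n]] by (auto simp: H_def)
        then show ?thesis by (intro image_eqI[of _ _ 0]) simp_all
      qed
    qed
    then have "F = ?C" using Fscale[OF F1] by auto
    with assms(12) show False by (simp add: weakly_ergodic_def F_def)
  qed
  have H_uminus: "- n \<in> H" if "n \<in> H" for n
    using that S_star unitary_star unfolding H_def by blast
  have H_add: "m + n \<in> H" if "m \<in> H" "n \<in> H" for m n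
    using that S_mult unitary_mult unfolding H_def by blast
  obtain n where "n \<in> H" "n \<noteq> 0" using H_nontrivial by blast
  then have n0: "nat \<bar>n\<bar> > 0 \<and> int (nat \<bar>n\<bar>) \<in> H"
    using H_uminus[of n] by (auto simp: abs_if)
  define k where "k = (LEAST k :: nat. k > 0 \<and> int k \<in> H)"
  have k: "k > 0" "int k \<in> H" using LeastI[of "\<lambda>k. k > 0 \<and> int k \<in> H", OF n0] by (simp_all add: k_def)
  have k_least: "k \<le> m" if "m > 0" "int m \<in> H" for m using that by (simp add: k_def Least_le)
  obtain W where W: "W \<in> S (int k)" "unitary W" using k(2) by (auto simp: H_def)
  have "1 \<in> S 0" using F1 by (auto simp: S_def hom_iota intro: exI[of _ 1])
  have Wpow: "unitary_power W j \<in> S (j * int k)" for j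
  proof (induction j rule: int_induct[where k = 0])
    case base
    then show ?case using \<open>1 \<in> S 0\<close> by simp
  next
    case (step1 j)
    then show ?case
      using S_mult[OF step1(2) W(1)] by (simp add: unitary_power_add[OF W(2)] distrib_right)
  next
    case (step2 j)
    have "unitary_power W (j - 1) = unitary_power W j * star W"
      using unitary_power_add[OF W(2), of j "- 1"] by (simp add: unitary_power_def)
    then show ?case using S_mult[OF step2(2) S_star[OF W(1)]] by (simp add: algebra_simps)
  qed
  have H_dvd: "\<exists>j. n = j * int k" if "n \<in> H" for n
  proof -
    \<comment> \<open>A power of W lowers the degree n to its remainder modulo k, which minimality
      of k forces to be 0.\<close>
    have "- (n div int k) * int k \<in> H" using Wpow unitary_unitary_power[OF W(2)] unfolding H_def by blast
    from H_add[OF that this] have "n mod int k \<in> H"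
      by (simp add: minus_div_mult_eq_mod[symmetric])
    moreover have "0 \<le> n mod int k" "n mod int k < int k" using k(1) by simp_all
    ultimately have "n mod int k = 0"
      using k_least[of "nat (n mod int k)"] by (cases "n mod int k = 0") (simp_all add: le_nat_iff)
    then show ?thesis by (metis dvd_def mod_0_imp_dvd mult.commute)
  qed
  have S_W: "\<exists>c j. y = c *\<^sub>C unitary_power W j" if y: "y \<in> S n" for y n
  proof (cases "y = 0")
    case True
    then show ?thesis by (intro exI[of _ 0]) simp
  next
    case False
    then obtain j where j: "n = j * int k" using H_dvd S_unitary[OF y] by (auto simp: H_def)
    \<comment> \<open>Cancelling the degree of y with a power of W leaves a fixed point of degree 0,
      hence a scalar.\<close>
    obtain c where "y * unitary_power W (- j) = c *\<^sub>C 1"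
      using S_0 S_mult[OF y Wpow[of "- j"]] by (auto simp: j)
    then have "y * (unitary_power W (- j) * unitary_power W j) = c *\<^sub>C unitary_power W j"
      by (simp add: mult_scaleC_left flip: mult.assoc)
    then show ?thesis by (auto simp flip: unitary_power_add[OF W(2)])
  qed
  \<comment> \<open>Positivity of k matters: it puts distinct powers of W into distinct gauge
    degrees.\<close>
  have fourier_W: "fourier (n * int k) (unitary_power W m) = (if m = n then unitary_power W n else 0)" for m n
    using Wpow[of m] k(1) by (auto simp: S_def fourier_basis)
  have "\<exists>\<Psi> :: (circle \<Rightarrow>\<^sub>C complex) \<Rightarrow> 'b.
      unital_star_hom \<Psi> \<and> (\<forall>f. norm (\<Psi> f) = norm f) \<and> \<Psi> circle_coord = W"
  proof (rule circle_star_hom_exists[OF W(2)])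
    fix f :: "int \<Rightarrow> complex" and n assume f: "finitely_supported f"
    let ?x = "integrated_form (\<lambda>c. c *\<^sub>C 1) W f"
    have "fourier (n * int k) ?x = (\<Sum>m | f m \<noteq> 0. f m *\<^sub>C (if m = n then unitary_power W n else 0))"
      by (simp add: integrated_form_def bounded_linear.linear[OF bounded_linear_fourier, THEN linear_sum]
          mult_scaleC_left fourier_scaleC fourier_W)
    also have "\<dots> = f n *\<^sub>C unitary_power W n"
      using f by (simp add: finitely_supported_def if_distrib cong: if_cong)
    finally have "cmod (f n) = norm (fourier (n * int k) ?x)"
      by (simp add: norm_scaleC norm_unitary unitary_unitary_power W(2))
    then show "cmod (f n) \<le> norm ?x" using norm_fourier_le by metis
  qed
  then obtain \<Psi> :: "(circle \<Rightarrow>\<^sub>C complex) \<Rightarrow> 'b" where \<Psi>: "unital_star_hom \<Psi>"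
    and iso: "\<And>f. norm (\<Psi> f) = norm f" and \<Psi>_coord: "\<Psi> circle_coord = W" by blast
  note hom_\<Psi> = unital_star_homD[OF \<Psi>] and lin_\<Psi> = bounded_linear_star_hom[OF \<Psi>]
  have "{f. \<Psi> f \<in> F} = UNIV"
  proof (rule closed_star_subalgebra_circle_coord)
    show "unital_star_subalgebra {f. \<Psi> f \<in> F}"
      using F_alg by (simp add: unital_star_subalgebra_def hom_\<Psi>)
    have "closed (\<Psi> -` F)"
      by (intro continuous_closed_vimage F_closed linear_continuous_at lin_\<Psi>)
    then show "closed {f. \<Psi> f \<in> F}" by (simp add: vimage_def)
    show "circle_coord \<in> {f. \<Psi> f \<in> F}" using W(1) by (simp add: \<Psi>_coord S_def)
  qed
  moreover have "x \<in> range \<Psi>" if x: "x \<in> F" for x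
  proof (rule mem_if_fourier_mem)
    \<comment> \<open>The isometry makes the range complete, so Fejer summation can be carried out
      inside it.\<close>
    show "closed (range \<Psi>)" by (rule closed_range_isometric[OF lin_\<Psi> iso])
    show "subspace (range \<Psi>)" by (rule subspace_range[OF lin_\<Psi>])
    fix n
    obtain c j where "fourier n x = c *\<^sub>C unitary_power W j" using S_W[OF fourier_S[OF x]] by blast
    also have "\<dots> = \<Psi> (c *\<^sub>C unitary_power circle_coord j)"
    proof -
      have "\<Psi> (z ^ i) = \<Psi> z ^ i" for z i by (induction i) (simp_all add: hom_\<Psi>)
      then show ?thesis by (simp add: unitary_power_def hom_\<Psi> \<Psi>_coord)
    qed
    finally show "fourier n x \<in> range \<Psi>" by simp
  qed
  ultimately have "range \<Psi> = F" by auto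
  moreover have "inj \<Psi>"
  proof (rule injI)
    fix f g assume "\<Psi> f = \<Psi> g"
    then have "norm (f - g) = 0"
      using iso[of "f - g"] bounded_linear.linear[OF lin_\<Psi>] by (simp add: linear_diff)
    then show "f = g" by simp
  qed
  ultimately show ?thesis using \<Psi> by (auto simp: bij_betw_def F_def)
qed

end
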